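(* Let $\phi:\mathbb{R}^n\to\mathbb{R}$, a set-valued mapping $\mathcal{H}:\mathbb{R}^n\rightrightarrows\mathbb{R}^n$, a positive sequence $\{\eta_k\}_{k\ge 0}$, and sequences $\{x_k\},\{d_k\},\{\xi_k\}\subset\mathbb{R}^n$ satisfy $$\nabla\phi(x_{k+1})=\nabla\phi(x_k)-\eta_k(d_k+\xi_k)\quad\text{for all }k\ge 0,$$ and suppose that: (1) $\phi$ is a supercoercive Legendre kernel function over $\mathbb{R}^n$, and $\nabla\phi$ is differentiable almost everywhere; (2) $\{x_k\}$, $\{\nabla\phi(x_k)\}$ and $\{d_k\}$ are uniformly bounded; (3) $\sum_{k=0}^\infty\eta_k=\infty$ and $\lim_{k\to\infty}\eta_k=0$; (4) for any $T>0$, $\lim_{s\to\infty}\sup_{s\le i\le\Lambda_\eta(\lambda_\eta(s)+T)}\left\|\sum_{k=s}^i\eta_k\xi_k\right\|=0$; (5) $\mathcal{H}$ has a closed graph, and for any unbounded increasing sequence of indices $\{k_j\}$ such that $x_{k_j}\to\bar x$, it holds that $\lim_{N\to\infty}\mathrm{dist}\left(\frac1N\sum_{j=1}^N d_{k_j},\mathcal{H}(\bar x)\right)=0$. Suppose moreover that there is a continuous function $\Psi:\mathbb{R}^n\to\mathbb{R}$ such that: (6) the set $\{\Psi(x):0\in\mathcal{H}(x)\}$ has empty interior in $\mathbb{R}$; (7) $\Psi$ is bounded below, and for any trajectory $z(\cdot)$ of the differential inclusion $\frac{d}{dt}\nabla\phi(z(t))\in-\mathcal{H}(z(t))$ with $z(0)\notin\mathcal{H}^{-1}(0)$,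 there exists $T>0$ such that $\Psi(z(T))<\sup_{t\in[0,T]}\Psi(z(t))\le\Psi(z(0))$. Then any cluster point of $\{x_k\}$ lies in $\mathcal{H}^{-1}(0)$, and the function values $\{\Psi(x_k)\}_{k\ge1}$ converge.
   Context: A Legendre kernel function over $\mathbb{R}^n$ is a strictly convex function $\phi\in\mathcal{C}^1(\mathbb{R}^n)$ such that $\|\nabla\phi(u_k)\|\to\infty$ whenever $\|u_k\|\to\infty$. It is supercoercive if $\lim_{\|u\|\to\infty}\phi(u)/\|u\|=\infty$; in that case $\nabla\phi$ is invertible with continuous inverse $\nabla\phi^*$, $\phi^*$ the Fenchel conjugate. For a positive sequence $\{\eta_k\}$: $\lambda_\eta(0)=0$, $\lambda_\eta(k)=\sum_{i=0}^{k-1}\eta_i$ for $k\ge1$, and $\Lambda_\eta(t)=\sup\{k:\lambda_\eta(k)\le t\}$. $\mathcal{H}$ has a closed graph if $\{(x,y):y\in\mathcal{H}(x)\}$ is closed. $\mathrm{dist}(w,A)=\inf\{\|w-u\|:u\in A\}$ with $\mathrm{dist}(w,\emptyset)=\infty$. $\mathcal{H}^{-1}(0)=\{x\in\mathbb{R}^n:0\in\mathcal{H}(x)\}$ is the stable set. A trajectory of the differential inclusion is an absolutely continuous solution $z:\mathbb{R}_+\to\mathbb{R}^n$, i.e. the inclusion holds for almost all $t\ge0$.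
   Formalization: In (7), a trajectory is a curve z for which ∇φ(z(t)), rather than z(t) itself, is absolutely continuous (on every [0,T]); requiring it of z makes the claim false when ∇φ* is merely continuous, since (7) can then be vacuous. *)

theory Defs
  imports "HOL-Analysis.Analysis"
begin

text \<open>Meaningful only where \<open>f\<close> is differentiable.\<close>
definition grad :: "('a::real_inner \<Rightarrow> real) \<Rightarrow> 'a \<Rightarrow> 'a" where
  "grad f x = (THE D. GDERIV f x :> D)"

definition strictly_convex :: "('a::real_vector \<Rightarrow> real) \<Rightarrow> bool" where
  "strictly_convex f \<longleftrightarrow>
     (\<forall>x y u. x \<noteq> y \<and> 0 < u \<and> u < 1 \<longrightarrow>
        f ((1 - u) *\<^sub>R x + u *\<^sub>R y) < (1 - u) * f x + u * f y)"

definition C1_function :: "('a::real_inner \<Rightarrow> real) \<Rightarrow> bool" where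
  "C1_function f \<longleftrightarrow> (\<forall>x. \<exists>D. GDERIV f x :> D) \<and> continuous_on UNIV (grad f)"

definition legendre_kernel :: "('a::real_inner \<Rightarrow> real) \<Rightarrow> bool" where
  "legendre_kernel f \<longleftrightarrow> strictly_convex f \<and> C1_function f \<and>
     (\<forall>u. filterlim (\<lambda>k. norm (u k)) at_top sequentially \<longrightarrow>
          filterlim (\<lambda>k. norm (grad f (u k))) at_top sequentially)"

definition supercoercive :: "('a::real_normed_vector \<Rightarrow> real) \<Rightarrow> bool" where
  "supercoercive f \<longleftrightarrow> filterlim (\<lambda>u. f u / norm u) at_top at_infinity"

definition step_time :: "(nat \<Rightarrow> real) \<Rightarrow> nat \<Rightarrow> real" where
  "step_time \<eta> k = (\<Sum>i<k. \<eta> i)"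

text \<open>The supremum is a genuine maximum when \<open>t \<ge> 0\<close>, \<open>\<eta>\<close> is positive and
  \<open>\<Sum>\<eta> = \<infinity>\<close>: the set is then finite and contains \<open>0\<close>.\<close>
definition step_index :: "(nat \<Rightarrow> real) \<Rightarrow> real \<Rightarrow> nat" where
  "step_index \<eta> t = Sup {k. step_time \<eta> k \<le> t}"

text \<open>Extended-real valued, so that the distance to the empty set is \<open>\<infinity>\<close>
  (whereas \<open>infdist w {} = 0\<close>).\<close>
definition edist_set :: "'a::real_normed_vector \<Rightarrow> 'a set \<Rightarrow> ereal" where
  "edist_set w A = (INF u\<in>A. ereal (norm (w - u)))"

definition closed_graph :: "('a::topological_space \<Rightarrow> 'b::topological_space set) \<Rightarrow> bool" where
  "closed_graph H \<longleftrightarrow> closed {(x, y). y \<in> H x}"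

definition stable_set :: "('a \<Rightarrow> 'b::zero set) \<Rightarrow> 'a set" where
  "stable_set H = {x. 0 \<in> H x}"

definition abs_cont_on :: "real set \<Rightarrow> (real \<Rightarrow> 'a::real_normed_vector) \<Rightarrow> bool" where
  "abs_cont_on S f \<longleftrightarrow>
     (\<forall>\<epsilon>>0. \<exists>\<delta>>0. \<forall>(n::nat) a b.
        (\<forall>i<n. a i \<le> b i \<and> {a i..b i} \<subseteq> S) \<and>
        disjoint_family_on (\<lambda>i. {a i<..<b i}) {..<n} \<and>
        (\<Sum>i<n. b i - a i) < \<delta> \<longrightarrow>
        (\<Sum>i<n. norm (f (b i) - f (a i))) < \<epsilon>)"

text \<open>Trajectories of \<open>d/dt \<nabla>\<phi>(z(t)) \<in> - H(z(t))\<close>. As usual for solutions on an unbounded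
  interval, absolute continuity is on compact subintervals. It is required of the curve
  \<open>t \<mapsto> \<nabla>\<phi>(z(t))\<close> that the inclusion differentiates. For a supercoercive Legendre kernel
  \<open>z = \<nabla>\<phi>\<^sup>* \<circ> (\<nabla>\<phi> \<circ> z)\<close> is then continuous, but as \<open>\<nabla>\<phi>\<^sup>*\<close> is only continuous, \<open>z\<close>
  itself need not be absolutely continuous. The derivative at \<open>t\<close> is
  taken within \<open>{0..}\<close>, so values of \<open>z\<close> at negative times are irrelevant.\<close>
definition trajectory ::
    "('a::real_inner \<Rightarrow> real) \<Rightarrow> ('a \<Rightarrow> 'a set) \<Rightarrow> (real \<Rightarrow> 'a) \<Rightarrow> bool" where
  "trajectory \<phi> H z \<longleftrightarrow>
     (\<forall>T>0. abs_cont_on {0..T} (\<lambda>t. grad \<phi> (z t))) \<and>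
     (AE t in lebesgue. t \<ge> 0 \<longrightarrow>
        (\<exists>v. ((\<lambda>s. grad \<phi> (z s)) has_vector_derivative v) (at t within {0..}) \<and>
             v \<in> uminus ` H (z t)))"

definition cluster_point :: "(nat \<Rightarrow> 'a::topological_space) \<Rightarrow> 'a \<Rightarrow> bool" where
  "cluster_point x l \<longleftrightarrow> (\<exists>r::nat \<Rightarrow> nat. strict_mono r \<and> (\<lambda>j. x (r j)) \<longlonglongrightarrow> l)"

end

theory Submission
  imports Defs "HOL-Complex_Analysis.Great_Picard"
begin

text \<open>
  The dual iterates \<open>y\<^sub>k = \<nabla>\<phi>(x\<^sub>k)\<close> form an Euler scheme with steps \<open>\<eta>\<^sub>k\<close> and perturbed
  velocities \<open>-(d\<^sub>k + \<xi>\<^sub>k)\<close>, and the proof compares it with the differential inclusion. Over a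
  bounded amount of step time the noise sums up to something negligible and the \<open>d\<^sub>k\<close> are
  bounded, so the piecewise constant curves that start at \<open>y\<^sub>m\<close> are asymptotically Lipschitz as
  \<open>m \<rightarrow> \<infinity>\<close>. By an Arzela-Ascoli argument, whenever \<open>x\<close> converges along a subsequence, a
  further subsequence of these curves converges locally uniformly to a Lipschitz curve \<open>y\<close>. As
  \<open>\<nabla>\<phi>\<close> is injective by strict convexity, it is a homeomorphism on the compact closure of the
  iterates, and \<open>y = \<nabla>\<phi> \<circ> z\<close> for a continuous curve \<open>z\<close> (lemma \<open>limit_trajectory\<close>).

  That \<open>z\<close> solves the inclusion rests on two facts. A Lipschitz curve has a derivative almost
  everywhere (\<open>lipschitz_AE_differentiable\<close>, by Vitali coverings). And at a point of
  differentiability, \<open>-y'(t)\<close> cannot be separated by a linear functional from the \<open>d\<^sub>i\<close> with \<open>i\<close>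
  large and \<open>x\<^sub>i\<close> near \<open>z(t)\<close>, since the increments of \<open>y\<close> are limits of averages of exactly these
  \<open>d\<^sub>i\<close>. Without separation a greedy choice of indices yields plain averages of \<open>d\<close> that
  converge to \<open>-y'(t)\<close> (\<open>greedy_averages\<close>), and the hypothesis on averages places the limit in
  \<open>H (z t)\<close>. Convexity of the values of \<open>H\<close> is thus replaced by that hypothesis.

  Suppose now that \<open>\<Psi>(x\<^sub>k)\<close> diverges. Between its extreme cluster values there is a level \<open>a\<close>
  that is not a critical value, and \<open>\<Psi>(x\<^sub>k)\<close> climbs infinitely often from a last visit to
  \<open>{\<Psi> \<le> a}\<close> to above some \<open>b > a\<close> (\<open>divergent_upcrossings\<close>). A limit trajectory started at
  these last visits begins on the level \<open>a\<close>, stays in \<open>{\<Psi> \<le> a}\<close> for some time and is strictly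
  below \<open>a\<close> at the end of it. The iterates follow it and so return to \<open>{\<Psi> \<le> a}\<close> before they can
  reach \<open>b\<close>, a contradiction (\<open>no_upcrossings_of_noncritical_value\<close>). Once \<open>\<Psi>(x\<^sub>k)\<close>
  converges, \<open>\<Psi>\<close> is constant on every limit trajectory; hence strict descent never happens and
  all cluster points are stable (\<open>limit_point_stable\<close>).
\<close>

section \<open>Lipschitz curves\<close>

text \<open>Since \<open>t\<close> is required to be interior to the short intervals, the set is a countable
  intersection of open sets, and measurability comes for free.\<close>
definition steep_points :: "(real \<Rightarrow> real) \<Rightarrow> real \<Rightarrow> real set" where
  "steep_points f q =
     (\<Inter>n::nat. \<Union>{{u<..<v} | u v. v - u < 1 / real (Suc n) \<and> q * (v - u) < f v - f u})"

lemma steep_points_iff: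
  "t \<in> steep_points f q \<longleftrightarrow>
     (\<forall>e>0. \<exists>u v. u < t \<and> t < v \<and> v - u < e \<and> q * (v - u) < f v - f u)"
proof -
  have "t \<in> \<Union>{{u<..<v} | u v. v - u < e \<and> q * (v - u) < f v - f u} \<longleftrightarrow>
      (\<exists>u v. u < t \<and> t < v \<and> v - u < e \<and> q * (v - u) < f v - f u)" for e
    by (auto simp del: greaterThanLessThan_iff) (metis greaterThanLessThan_iff)+
  then have "t \<in> steep_points f q \<longleftrightarrow>
      (\<forall>n. \<exists>u v. u < t \<and> t < v \<and> v - u < 1 / real (Suc n) \<and> q * (v - u) < f v - f u)"
    by (simp only: steep_points_def INT_iff UNIV_I simp_thms ball_UNIV)
  also have "\<dots> \<longleftrightarrow> (\<forall>e>0. \<exists>u v. u < t \<and> t < v \<and> v - u < e \<and> q * (v - u) < f v - f u)"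
  proof (intro iffI allI impI)
    fix e :: real assume *: "\<forall>n. \<exists>u v. u < t \<and> t < v \<and> v - u < 1 / real (Suc n) \<and>
      q * (v - u) < f v - f u" and "0 < e"
    obtain n where "1 / real (Suc n) < e" using \<open>0 < e\<close> by (rule nat_approx_posE)
    then show "\<exists>u v. u < t \<and> t < v \<and> v - u < e \<and> q * (v - u) < f v - f u"
      using * by (meson less_trans)
  next
    fix n assume *: "\<forall>e>0. \<exists>u v. u < t \<and> t < v \<and> v - u < e \<and> q * (v - u) < f v - f u"
    show "\<exists>u v. u < t \<and> t < v \<and> v - u < 1 / real (Suc n) \<and> q * (v - u) < f v - f u"
      by (rule *[rule_format]) simp
  qed
  finally show ?thesis .
qed

lemma steep_points_borel [measurable]: "steep_points f q \<in> sets borel"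
proof -
  have "open (\<Union>{{u<..<v} | u v. v - u < 1 / real (Suc n) \<and> q * (v - u) < f v - f u})" for n
    by (rule open_Union) auto
  then show ?thesis
    unfolding steep_points_def by (intro sets.countable_INT) auto
qed

lemma sum_increments_le:
  fixes g :: "real \<Rightarrow> real"
  assumes "mono g" "finite F" "a \<le> b"
    and "\<And>u v. (u, v) \<in> F \<Longrightarrow> a \<le> u \<and> u \<le> v \<and> v \<le> b"
    and "pairwise (\<lambda>p q. disjnt {fst p..snd p} {fst q..snd q}) F"
  shows "(\<Sum>p\<in>F. g (snd p) - g (fst p)) \<le> g b - g a"
  using assms(2-)
proof (induction "card F" arbitrary: F b)
  case 0
  then show ?case using monoD[OF \<open>mono g\<close> \<open>a \<le> b\<close>] by simp
next
  case (Suc k)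
  then have "F \<noteq> {}" "finite F" by auto
  \<comment> \<open>Split off the rightmost interval; the others lie to the left of it.\<close>
  obtain p where p: "p \<in> F" "\<And>q. q \<in> F \<Longrightarrow> snd q \<le> snd p"
  proof -
    have "Max (snd ` F) \<in> snd ` F" using \<open>F \<noteq> {}\<close> \<open>finite F\<close> by (intro Max_in) auto
    then obtain p where "p \<in> F" "snd p = Max (snd ` F)" by force
    then show thesis using that[of p] \<open>finite F\<close> by simp
  qed
  have left: "snd q \<le> fst p" if "q \<in> F - {p}" for q
  proof (rule ccontr)
    assume "\<not> ?thesis"
    moreover have "fst q \<le> snd q" using Suc.prems(3)[of "fst q" "snd q"] that by simp
    moreover have "snd q \<le> snd p" using p(2) that by simp
    ultimately have "snd q \<in> {fst p..snd p}" "snd q \<in> {fst q..snd q}" by auto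
    moreover have "disjnt {fst p..snd p} {fst q..snd q}"
      using pairwiseD[OF Suc.prems(4) p(1), of q] that by auto
    ultimately show False unfolding disjnt_iff by blast
  qed
  have pab: "a \<le> fst p" "fst p \<le> snd p" "snd p \<le> b"
    using Suc.prems(3)[of "fst p" "snd p"] p(1) by auto
  have "(\<Sum>q\<in>F - {p}. g (snd q) - g (fst q)) \<le> g (fst p) - g a"
  proof (rule Suc.hyps(1))
    show "k = card (F - {p})" using Suc.hyps(2) p(1) \<open>finite F\<close> by simp
    show "finite (F - {p})" using \<open>finite F\<close> by simp
    show "a \<le> fst p" by fact
    show "a \<le> u \<and> u \<le> v \<and> v \<le> fst p" if "(u, v) \<in> F - {p}" for u v
      using Suc.prems(3)[of u v] left[of "(u, v)"] that by auto
    show "pairwise (\<lambda>p q. disjnt {fst p..snd p} {fst q..snd q}) (F - {p})"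
      using Suc.prems(4) by (rule pairwise_subset) auto
  qed
  moreover have "(\<Sum>q\<in>F. g (snd q) - g (fst q))
      = (g (snd p) - g (fst p)) + (\<Sum>q\<in>F - {p}. g (snd q) - g (fst q))"
    using p(1) \<open>finite F\<close> by (simp add: sum.remove)
  moreover have "g (snd p) \<le> g b" using \<open>mono g\<close> pab(3) by (rule monoD)
  ultimately show ?case by linarith
qed

text \<open>The short intervals of slope above \<open>q\<close> around the points of \<open>E\<close> form a Vitali cover.
  Disjoint members of it have total increment at most \<open>g b - g a\<close>, hence total length at most
  \<open>(g b - g a) / q\<close>.\<close>
lemma measure_steep_points_le:
  fixes g :: "real \<Rightarrow> real"
  assumes "mono g" "a \<le> b" and E: "E \<in> lmeasurable" "E \<subseteq> steep_points g q \<inter> {a..b}"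
  shows "q * measure lebesgue E \<le> g b - g a"
proof (cases "q \<le> 0")
  case True
  then have "q * measure lebesgue E \<le> 0" by (simp add: mult_nonpos_nonneg)
  also have "\<dots> \<le> g b - g a" using monoD[OF assms(1,2)] by simp
  finally show ?thesis .
next
  case False
  then have "q > 0" by simp
  define K where "K = {(u, v). a \<le> u \<and> u < v \<and> v \<le> b \<and> q * (v - u) < g v - g u}"
  define mid rad where "mid = (\<lambda>p::real \<times> real. (fst p + snd p) / 2)"
    and "rad = (\<lambda>p::real \<times> real. (snd p - fst p) / 2)"
  have cb: "cball (mid p) (rad p) = {fst p..snd p}" for p
    by (simp add: mid_def rad_def cball_eq_atLeastAtMost field_simps)
  have "\<exists>p. p \<in> K \<and> t \<in> cball (mid p) (rad p) \<and> rad p < e"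
    if t: "t \<in> E - {a, b}" and "0 < e" for t e
  proof -
    have "a < t" "t < b" "t \<in> steep_points g q" using t E(2) by force+
    then obtain u v where uv: "u < t" "t < v" "v - u < min e (min (t - a) (b - t))"
        "q * (v - u) < g v - g u"
      using \<open>0 < e\<close> \<open>a < t\<close> \<open>t < b\<close> steep_points_iff[of t g q]
      by (metis diff_gt_0_iff_gt min_less_iff_conj)
    then have "(u, v) \<in> K" by (auto simp: K_def)
    moreover have "t \<in> cball (mid (u, v)) (rad (u, v))" using uv unfolding cb by simp
    moreover have "rad (u, v) < e" using uv by (simp add: rad_def)
    ultimately show ?thesis by blast
  qed
  note fine = this
  have pos: "0 < rad p" if "p \<in> K" for p using that by (auto simp: K_def rad_def)
  obtain C where C: "countable C" "C \<subseteq> K"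
      "pairwise (\<lambda>i j. disjnt (cball (mid i) (rad i)) (cball (mid j) (rad j))) C"
      "negligible ((E - {a, b}) - (\<Union>i\<in>C. cball (mid i) (rad i)))"
    by (rule Vitali_covering_theorem_cballs[of K rad "E - {a, b}" mid, OF pos fine])
  note C = C[unfolded cb]
  have fin: "measure lebesgue (\<Union>p\<in>F. {fst p..snd p}) \<le> (g b - g a) / q"
    if F: "F \<subseteq> C" "finite F" for F
  proof -
    have K: "a \<le> fst p" "fst p < snd p" "snd p \<le> b"
        "q * (snd p - fst p) \<le> g (snd p) - g (fst p)" if "p \<in> F" for p
      using that F(1) C(2) by (auto simp: K_def)
    have "measure lebesgue (\<Union>p\<in>F. {fst p..snd p}) \<le> (\<Sum>p\<in>F. measure lebesgue {fst p..snd p})"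
      using F by (intro measure_UNION_le) auto
    also have "\<dots> = (\<Sum>p\<in>F. snd p - fst p)"
      using K(2) by (intro sum.cong) (auto simp: less_imp_le)
    finally have "q * measure lebesgue (\<Union>p\<in>F. {fst p..snd p}) \<le> q * (\<Sum>p\<in>F. snd p - fst p)"
      using \<open>q > 0\<close> by simp
    also have "\<dots> \<le> (\<Sum>p\<in>F. g (snd p) - g (fst p))"
      unfolding sum_distrib_left by (intro sum_mono K(4))
    also have "\<dots> \<le> g b - g a"
    proof (rule sum_increments_le)
      show "a \<le> u \<and> u \<le> v \<and> v \<le> b" if "(u, v) \<in> F" for u v
        using K[OF that] by simp
      show "pairwise (\<lambda>p q. disjnt {fst p..snd p} {fst q..snd q}) F"
        using C(3) F(1) by (rule pairwise_subset)
    qed (use F assms in auto)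
    finally show ?thesis using \<open>q > 0\<close> by (simp add: field_simps)
  qed
  have U: "(\<Union>p\<in>C. {fst p..snd p}) \<in> lmeasurable"
      "measure lebesgue (\<Union>p\<in>C. {fst p..snd p}) \<le> (g b - g a) / q"
    by (rule fmeasurable_UN_bound[OF C(1) _ fin] measure_UN_bound[OF C(1) _ fin]; simp)+
  have "negligible (E - (\<Union>p\<in>C. {fst p..snd p}))"
    by (rule negligible_subset[of "((E - {a, b}) - (\<Union>p\<in>C. {fst p..snd p})) \<union> {a, b}"])
      (use C(4) in \<open>auto intro: negligible_Un\<close>)
  then have "measure lebesgue (E - (\<Union>p\<in>C. {fst p..snd p})) = 0"
    by (rule negligible_imp_measure0)
  moreover have "measure lebesgue E \<le> measure lebesgue
      ((\<Union>p\<in>C. {fst p..snd p}) \<union> (E - (\<Union>p\<in>C. {fst p..snd p})))"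
    using E(1) U(1) by (intro measure_mono_fmeasurable) auto
  moreover have "\<dots> \<le> measure lebesgue (\<Union>p\<in>C. {fst p..snd p})
      + measure lebesgue (E - (\<Union>p\<in>C. {fst p..snd p}))"
    using E(1) U(1) by (intro measure_Un_le) auto
  ultimately have "measure lebesgue E \<le> measure lebesgue (\<Union>p\<in>C. {fst p..snd p})"
    by simp
  with U(2) have "measure lebesgue E \<le> (g b - g a) / q" by simp
  then show ?thesis using \<open>q > 0\<close> by (simp add: field_simps)
qed

text \<open>Covering \<open>E\<close> by nonoverlapping intervals of total length at most \<open>|E| + e\<close> and adding up
  the density bounds gives \<open>|E| \<le> \<theta> (|E| + e)\<close> for every \<open>e > 0\<close>.\<close>
lemma negligible_density_bounded_below_one:
  fixes E :: "real set"
  assumes E: "E \<in> lmeasurable" "E \<subseteq> {a..b}" and "\<theta> < 1"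
    and density: "\<And>c d. c \<le> d \<Longrightarrow> measure lebesgue (E \<inter> {c..d}) \<le> \<theta> * (d - c)"
  shows "negligible E"
proof -
  let ?m = "measure lebesgue"
  have "0 \<le> \<theta>" using density[of 0 1] order_trans[OF measure_nonneg] by fastforce
  have le: "?m E \<le> \<theta> * (?m E + e)" if "0 < e" for e
  proof -
    obtain D where D: "countable D"
        "\<And>K. K \<in> D \<Longrightarrow> K \<subseteq> cbox a b \<and> K \<noteq> {} \<and> (\<exists>c d. K = cbox c d)"
        "pairwise (\<lambda>A B. interior A \<inter> interior B = {}) D"
        "E \<subseteq> \<Union>D" "\<Union>D \<in> lmeasurable" "?m (\<Union>D) \<le> ?m E + e"
      using measurable_outer_intervals_bounded[OF E(1), of a b e] E(2) \<open>0 < e\<close>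
      by (metis box_real(2))
    have fin: "?m (\<Union>K\<in>F. E \<inter> K) \<le> \<theta> * ?m (\<Union>D)" if F: "F \<subseteq> D" "finite F" for F
    proof -
      have K: "\<exists>c d. c \<le> d \<and> K = {c..d}" if "K \<in> F" for K
        using D(2)[of K] that F(1) by (metis atLeastatMost_empty_iff2 box_real(2) subsetD)
      have "?m (\<Union>K\<in>F. E \<inter> K) \<le> (\<Sum>K\<in>F. ?m (E \<inter> K))"
        using F E(1) K by (intro measure_UNION_le) (metis fmeasurableD fmeasurable.Int lmeasurable_interval(1))+
      also have "\<dots> \<le> (\<Sum>K\<in>F. \<theta> * ?m K)"
      proof (intro sum_mono)
        fix K assume "K \<in> F"
        then obtain c d where "c \<le> d" "K = {c..d}" using K by blast
        then show "?m (E \<inter> K) \<le> \<theta> * ?m K" using density by simp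
      qed
      also have "\<dots> = \<theta> * ?m (\<Union>F)"
      proof -
        have "?m (\<Union>F) = (\<Sum>K\<in>F. ?m K)"
        proof (rule measure_negligible_finite_Union)
          show "pairwise (\<lambda>S T. negligible (S \<inter> T)) F"
          proof (rule pairwiseI)
            fix S T assume ST: "S \<in> F" "T \<in> F" "S \<noteq> T"
            then have "interior S \<inter> interior T = {}"
              using D(3) F(1) by (auto simp: pairwise_def)
            moreover obtain c d c' d' where "S = {c..d}" "T = {c'..d'}"
              using K ST by metis
            ultimately have "S \<inter> T \<subseteq> {c, d, c', d'}"
              by (auto simp: interior_atLeastAtMost_real)
            then show "negligible (S \<inter> T)"
              by (rule negligible_subset[rotated]) simp
          qed
        qed (use F K in auto)
        then show ?thesis by (simp add: sum_distrib_left)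
      qed
      also have "\<dots> \<le> \<theta> * ?m (\<Union>D)"
        using F K D(5) \<open>0 \<le> \<theta>\<close>
      proof (intro mult_left_mono measure_mono_fmeasurable sets.finite_Union)
        show "F \<subseteq> sets lebesgue"
          using K by (metis fmeasurableD lmeasurable_interval(1) subsetI)
      qed (use F in auto)
      finally show ?thesis .
    qed
    have "E = (\<Union>K\<in>D. E \<inter> K)" using D(4) by blast
    moreover have "?m (\<Union>K\<in>D. E \<inter> K) \<le> \<theta> * ?m (\<Union>D)"
    proof (rule measure_UN_bound[OF D(1) _ fin])
      show "E \<inter> K \<in> lmeasurable" if "K \<in> D" for K
        using D(2)[OF that] E(1) by (metis fmeasurable.Int lmeasurable_cbox)
    qed
    ultimately have "?m E \<le> \<theta> * ?m (\<Union>D)" by metis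
    also have "\<dots> \<le> \<theta> * (?m E + e)" using D(6) \<open>0 \<le> \<theta>\<close> by (rule mult_left_mono)
    finally show ?thesis .
  qed
  have "?m E \<le> \<theta> * ?m E"
  proof (rule field_le_epsilon)
    fix e :: real assume "0 < e"
    have "?m E \<le> \<theta> * ?m E + \<theta> * e" using le[OF \<open>0 < e\<close>] by (simp add: algebra_simps)
    also have "\<theta> * e \<le> e" using \<open>\<theta> < 1\<close> \<open>0 < e\<close> by simp
    finally show "?m E \<le> \<theta> * ?m E + e" by simp
  qed
  then have "(1 - \<theta>) * ?m E \<le> 0" by (simp add: algebra_simps)
  then have "?m E = 0" using \<open>\<theta> < 1\<close> measure_nonneg[of lebesgue E] by (simp add: mult_le_0_iff)
  then show ?thesis using E(1) by (simp add: negligible_iff_measure)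
qed

lemma steep_points_add_linear:
  "steep_points f q \<subseteq> steep_points (\<lambda>t. f t + L * t) (q + L)"
proof
  fix t assume t: "t \<in> steep_points f q"
  show "t \<in> steep_points (\<lambda>t. f t + L * t) (q + L)"
  proof (rule ccontr)
    assume "t \<notin> steep_points (\<lambda>t. f t + L * t) (q + L)"
    then obtain e where "0 < e" and e: "\<And>u v. u < t \<Longrightarrow> t < v \<Longrightarrow> v - u < e \<Longrightarrow>
        f v + L * v - (f u + L * u) \<le> (q + L) * (v - u)"
      unfolding steep_points_iff by (meson not_less)
    obtain u v where "u < t" "t < v" "v - u < e" "q * (v - u) < f v - f u"
      using t \<open>0 < e\<close> unfolding steep_points_iff by blast
    with e[of u v] show False by (simp add: algebra_simps)
  qed
qed

text \<open>Adding \<open>L t\<close> makes both \<open>f\<close> and \<open>-f\<close> nondecreasing. If \<open>E\<close> is the part of the set in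
  an interval \<open>[c, d]\<close>, then the slope bounds for the two functions add up to
  \<open>(q - p + 2 L) |E| \<le> 2 L (d - c)\<close>, where the left factor is the larger one.\<close>
lemma negligible_two_slopes:
  fixes f :: "real \<Rightarrow> real"
  assumes f: "L-lipschitz_on UNIV f" and "p < q"
  shows "negligible (steep_points f q \<inter> steep_points (\<lambda>t. - f t) (- p))"
    (is "negligible ?S")
proof -
  let ?m = "measure lebesgue"
  have "0 \<le> L" using f by (rule lipschitz_on_nonneg)
  have lip: "\<bar>f s - f t\<bar> \<le> L * \<bar>s - t\<bar>" for s t
    using lipschitz_onD[OF f, of s t] by (simp add: dist_real_def)
  have mono: "mono (\<lambda>t. f t + L * t)" "mono (\<lambda>t. - f t + L * t)"
  proof -
    show "mono (\<lambda>t. f t + L * t)" "mono (\<lambda>t. - f t + L * t)"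
    proof (safe intro!: monoI)
      fix s t :: real assume "s \<le> t"
      then have "\<bar>f t - f s\<bar> \<le> L * t - L * s"
        using lip[of t s] by (simp add: right_diff_distrib)
      then show "f s + L * s \<le> f t + L * t" "- f s + L * s \<le> - f t + L * t" by auto
    qed
  qed
  define \<theta> where "\<theta> = 2 * L / (q - p + 2 * L)"
  have den: "0 < q - p + 2 * L" using \<open>p < q\<close> \<open>0 \<le> L\<close> by simp
  have "\<theta> < 1" using den \<open>p < q\<close> by (simp add: \<theta>_def field_simps)
  have S: "?S \<in> sets borel" by measurable
  have density: "?m (?S \<inter> {c..d}) \<le> \<theta> * (d - c)" if "c \<le> d" for c d
  proof -
    have E: "?S \<inter> {c..d} \<in> lmeasurable"
      using S by (intro bounded_set_imp_lmeasurable) (auto intro: bounded_subset)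
    have "(q + L) * ?m (?S \<inter> {c..d}) \<le> (f d + L * d) - (f c + L * c)"
      by (rule measure_steep_points_le[OF mono(1) that E]) (use steep_points_add_linear in blast)
    moreover have "(- p + L) * ?m (?S \<inter> {c..d}) \<le> (- f d + L * d) - (- f c + L * c)"
      by (rule measure_steep_points_le[OF mono(2) that E]) (use steep_points_add_linear in blast)
    ultimately have "(q - p + 2 * L) * ?m (?S \<inter> {c..d}) \<le> 2 * L * (d - c)"
      by (simp add: algebra_simps)
    then show ?thesis using den by (simp add: \<theta>_def field_simps)
  qed
  have "negligible (?S \<inter> cbox a b)" for a b :: real
  proof (rule negligible_density_bounded_below_one[OF _ _ \<open>\<theta> < 1\<close>])
    show "?S \<inter> cbox a b \<in> lmeasurable"
      using S by (intro bounded_set_imp_lmeasurable) (auto intro: bounded_subset)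
    show "?S \<inter> cbox a b \<subseteq> {a..b}" by simp
    show "?m (?S \<inter> cbox a b \<inter> {c..d}) \<le> \<theta> * (d - c)" if "c \<le> d" for c d
    proof -
      have "?m (?S \<inter> cbox a b \<inter> {c..d}) \<le> ?m (?S \<inter> {c..d})"
        using S by (intro measure_mono_fmeasurable bounded_set_imp_lmeasurable)
          (auto intro: bounded_subset)
      with density[OF that] show ?thesis by simp
    qed
  qed
  then show ?thesis by (simp add: negligible_on_intervals[of ?S])
qed

text \<open>The derivative is the supremum \<open>l\<close> of all \<open>q\<close> such that \<open>t\<close> is a \<open>q\<close>-steep point: slopes over
  short intervals around \<open>t\<close> eventually stay below each number above \<open>l\<close> by definition, and
  above each number below \<open>l\<close> because \<open>t\<close> avoids the exceptional sets.\<close>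
lemma differentiable_if_not_two_slopes:
  fixes f :: "real \<Rightarrow> real"
  assumes f: "L-lipschitz_on UNIV f"
    and t: "\<And>p q. p \<in> \<rat> \<Longrightarrow> q \<in> \<rat> \<Longrightarrow> p < q \<Longrightarrow>
      t \<notin> steep_points f q \<inter> steep_points (\<lambda>t. - f t) (- p)"
  shows "f differentiable (at t)"
proof -
  have lip: "\<bar>f s - f t\<bar> \<le> L * \<bar>s - t\<bar>" for s t
    using lipschitz_onD[OF f, of s t] by (simp add: dist_real_def)
  have cont: "continuous_on UNIV f" using f by (rule lipschitz_on_continuous_on)
  define Q where "Q = {q. t \<in> steep_points f q}"
  define l where "l = Sup Q"
  have bdd: "q \<le> L" if q: "q \<in> Q" for q
  proof -
    obtain u v where "u < t" "t < v" "q * (v - u) < f v - f u"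
      using q unfolding Q_def mem_Collect_eq steep_points_iff by (metis zero_less_one)
    moreover from this have "f v - f u \<le> L * (v - u)" using lip[of v u] by simp
    ultimately have "q * (v - u) < L * (v - u)" "0 < v - u" by linarith+
    then have "q < L" by (metis mult_less_cancel_right_pos)
    then show ?thesis by simp
  qed
  then have bdd_above: "bdd_above Q" by (rule bdd_aboveI)
  have "Q \<noteq> {}"
  proof -
    \<comment> \<open>All slopes are at least \<open>-L\<close>, so \<open>-L - 1\<close> belongs to \<open>Q\<close>.\<close>
    have "\<exists>e>0. \<forall>u v. u < t \<longrightarrow> t < v \<longrightarrow> v - u < e \<longrightarrow> f v - f u \<le> (- L - 1) * (v - u)"
      if "- L - 1 \<notin> Q"
      using that unfolding Q_def mem_Collect_eq steep_points_iff by (meson not_less)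
    moreover have False if "0 < e"
        "\<forall>u v. u < t \<longrightarrow> t < v \<longrightarrow> v - u < e \<longrightarrow> f v - f u \<le> (- L - 1) * (v - u)" for e
    proof -
      have "f (t + e / 3) - f (t - e / 3) \<le> (- L - 1) * (2 * e / 3)"
        using that(2)[rule_format, of "t - e / 3" "t + e / 3"] \<open>0 < e\<close> by simp
      moreover have "\<bar>f (t + e / 3) - f (t - e / 3)\<bar> \<le> L * (2 * e / 3)"
        using lip[of "t + e / 3" "t - e / 3"] \<open>0 < e\<close> by simp
      moreover have "(- L - 1) * (2 * e / 3) = - (L * (2 * e / 3)) - 2 * e / 3"
        by (simp add: field_simps)
      ultimately show False using \<open>0 < e\<close> by linarith
    qed
    ultimately show ?thesis by blast
  qed
  have upper: "\<exists>e>0. \<forall>u v. u < t \<longrightarrow> t < v \<longrightarrow> v - u < e \<longrightarrow> f v - f u \<le> q * (v - u)"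
    if "l < q" for q
  proof -
    have "q \<notin> Q" using cSup_upper[OF _ bdd_above, of q] that unfolding l_def by force
    then show ?thesis unfolding Q_def mem_Collect_eq steep_points_iff by (meson not_less)
  qed
  have lower: "\<exists>e>0. \<forall>u v. u < t \<longrightarrow> t < v \<longrightarrow> v - u < e \<longrightarrow> p * (v - u) \<le> f v - f u"
    if "p < l" for p
  proof -
    obtain q where q: "q \<in> Q" "p < q"
      using \<open>p < l\<close> less_cSup_iff[OF \<open>Q \<noteq> {}\<close> bdd_above] unfolding l_def by blast
    obtain q' where q': "q' \<in> \<rat>" "p < q'" "q' < q" using q(2) Rats_dense_in_real by blast
    obtain p' where p': "p' \<in> \<rat>" "p < p'" "p' < q'" using q'(2) Rats_dense_in_real by blast
    have "t \<in> steep_points f q'"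
    proof (rule ccontr)
      assume "t \<notin> steep_points f q'"
      then obtain e where e: "0 < e"
          "\<And>u v. u < t \<Longrightarrow> t < v \<Longrightarrow> v - u < e \<Longrightarrow> f v - f u \<le> q' * (v - u)"
        unfolding steep_points_iff by (meson not_less)
      obtain u v where uv: "u < t" "t < v" "v - u < e" "q * (v - u) < f v - f u"
        using q(1) e(1) unfolding Q_def mem_Collect_eq steep_points_iff by blast
      then have "q * (v - u) < q' * (v - u)" "0 < v - u" using e(2)[OF uv(1-3)] by linarith+
      then have "q < q'" by (metis mult_less_cancel_right_pos)
      then show False using q'(3) by simp
    qed
    then have "t \<notin> steep_points (\<lambda>t. - f t) (- p')" using t[OF p'(1) q'(1) p'(3)] by blast
    then obtain e where e: "0 < e"
        "\<And>u v. u < t \<Longrightarrow> t < v \<Longrightarrow> v - u < e \<Longrightarrow> - f v - - f u \<le> - p' * (v - u)"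
      unfolding steep_points_iff by (meson not_less)
    have "p * (v - u) \<le> f v - f u" if "u < t" "t < v" "v - u < e" for u v
    proof -
      have "p * (v - u) \<le> p' * (v - u)" using p'(2) that by (intro mult_right_mono) auto
      then show ?thesis using e(2)[OF that] by simp
    qed
    with e(1) show ?thesis by blast
  qed
  have "(f has_real_derivative l) (at t)"
    unfolding has_field_derivative_iff LIM_eq
  proof (intro allI impI)
    fix r :: real assume "0 < r"
    then obtain e1 e2 where e1: "e1 > 0"
        "\<And>u v. u < t \<Longrightarrow> t < v \<Longrightarrow> v - u < e1 \<Longrightarrow> f v - f u \<le> (l + r / 2) * (v - u)"
      and e2: "e2 > 0"
        "\<And>u v. u < t \<Longrightarrow> t < v \<Longrightarrow> v - u < e2 \<Longrightarrow> (l - r / 2) * (v - u) \<le> f v - f u"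
      using upper[of "l + r / 2"] lower[of "l - r / 2"] by auto
    define e where "e = min e1 e2"
    have e: "\<bar>f v - f u - l * (v - u)\<bar> \<le> r / 2 * (v - u)"
      if "u < t" "t < v" "v - u < e" for u v
    proof -
      have "f v - f u \<le> l * (v - u) + r / 2 * (v - u)"
        using e1(2)[of u v] that by (simp add: e_def distrib_right)
      moreover have "l * (v - u) - r / 2 * (v - u) \<le> f v - f u"
        using e2(2)[of u v] that by (simp add: e_def left_diff_distrib)
      ultimately show ?thesis by linarith
    qed

    \<comment> \<open>By continuity the estimate persists when one end of the interval is \<open>t\<close> itself.\<close>
    have closed: "\<bar>f v - f u - l * (v - u)\<bar> \<le> r / 2 * (v - u)"
      if "u \<le> t" "t \<le> v" "v - u < e" "u < v" for u v
    proof -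
      let ?G = "\<lambda>s. r / 2 * ((v + s) - (u - s)) - \<bar>f (v + s) - f (u - s) - l * ((v + s) - (u - s))\<bar>"
      have "((\<lambda>s. ?G s) \<longlongrightarrow> ?G 0) (at_right 0)"
      proof -
        have "continuous_on UNIV ?G"
          by (intro continuous_intros continuous_on_compose2[OF cont]) auto
        then have "isCont ?G 0"
          by (simp add: continuous_on_eq_continuous_at)
        then have "(?G \<longlongrightarrow> ?G 0) (at 0)" by (simp only: isCont_def)
        then show ?thesis by (rule tendsto_within_subset) simp
      qed
      moreover have "\<forall>\<^sub>F s in at_right 0. 0 \<le> ?G s"
        unfolding eventually_at_right_field
      proof (intro exI[of _ "(e - (v - u)) / 3"] conjI allI impI)
        show "0 < (e - (v - u)) / 3" using that by simp
        fix s :: real assume "0 < s" "s < (e - (v - u)) / 3"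
        then show "0 \<le> ?G s" using e[of "u - s" "v + s"] that by (simp add: field_simps)
      qed
      ultimately have "0 \<le> ?G 0"
        by (rule tendsto_lowerbound) simp
      then show ?thesis by simp
    qed
    show "\<exists>s>0. \<forall>x. x \<noteq> t \<and> norm (x - t) < s \<longrightarrow> norm ((f x - f t) / (x - t) - l) < r"
    proof (intro exI[of _ e] conjI allI impI)
      show "0 < e" using e1(1) e2(1) by (simp add: e_def)
      fix x assume x: "x \<noteq> t \<and> norm (x - t) < e"
      have "\<bar>f x - f t - l * (x - t)\<bar> \<le> r / 2 * \<bar>x - t\<bar>"
      proof (cases "t < x")
        case True
        then show ?thesis using closed[of t x] x by simp
      next
        case False
        then have "\<bar>f t - f x - l * (t - x)\<bar> \<le> r / 2 * (t - x)"
          using closed[of x t] x by simp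
        moreover have "f x - f t - l * (x - t) = - (f t - f x - l * (t - x))"
          by (simp add: algebra_simps)
        moreover have "\<bar>x - t\<bar> = t - x" using False by simp
        ultimately show ?thesis by (metis abs_minus_cancel)
      qed
      moreover have "(f x - f t) / (x - t) - l = (f x - f t - l * (x - t)) / (x - t)"
        using x by (simp add: field_simps)
      ultimately have "norm ((f x - f t) / (x - t) - l) \<le> r / 2"
        using x by (simp add: abs_divide field_simps)
      then show "norm ((f x - f t) / (x - t) - l) < r" using \<open>0 < r\<close> by simp
    qed
  qed
  then show ?thesis unfolding real_differentiable_def by blast
qed

text \<open>Rademacher's theorem on the line. Rational pairs of slopes suffice, so the exceptional set is
  a countable union of null sets.\<close>
theorem lipschitz_AE_differentiable:
  fixes f :: "real \<Rightarrow> 'a::euclidean_space"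
  assumes f: "L-lipschitz_on UNIV f"
  shows "AE t in lebesgue. f differentiable (at t)"
proof -
  define B where "B = (\<Union>i\<in>Basis. \<Union>(p, q)\<in>{(p, q). p \<in> \<rat> \<and> q \<in> \<rat> \<and> p < q}.
    steep_points (\<lambda>t. f t \<bullet> i) q \<inter> steep_points (\<lambda>t. - (f t \<bullet> i)) (- p))"
  have lip: "L-lipschitz_on UNIV (\<lambda>t. f t \<bullet> i)" if "i \<in> Basis" for i
  proof (rule lipschitz_onI)
    show "0 \<le> L" using f by (rule lipschitz_on_nonneg)
    fix s t
    have "dist (f s \<bullet> i) (f t \<bullet> i) \<le> dist (f s) (f t)"
      using Basis_le_norm[OF that, of "f s - f t"] by (simp add: dist_norm inner_diff_left)
    also have "\<dots> \<le> L * dist s t" using f by (rule lipschitz_onD) auto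
    finally show "dist (f s \<bullet> i) (f t \<bullet> i) \<le> L * dist s t" .
  qed
  have "negligible B"
    unfolding B_def
  proof (rule negligible_countable_Union)
    show "countable ((\<lambda>i. \<Union>(p, q)\<in>{(p, q). p \<in> \<rat> \<and> q \<in> \<rat> \<and> p < q}.
      steep_points (\<lambda>t. f t \<bullet> i) q \<inter> steep_points (\<lambda>t. - (f t \<bullet> i)) (- p)) ` Basis)"
      by (intro countable_finite) simp
  next
    fix S assume "S \<in> (\<lambda>i. \<Union>(p, q)\<in>{(p, q). p \<in> \<rat> \<and> q \<in> \<rat> \<and> p < q}.
      steep_points (\<lambda>t. f t \<bullet> i) q \<inter> steep_points (\<lambda>t. - (f t \<bullet> i)) (- p)) ` Basis"
    then obtain i where i: "i \<in> Basis" and S: "S = (\<Union>(p, q)\<in>{(p, q). p \<in> \<rat> \<and> q \<in> \<rat> \<and> p < q}.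
      steep_points (\<lambda>t. f t \<bullet> i) q \<inter> steep_points (\<lambda>t. - (f t \<bullet> i)) (- p))" by blast
    have "countable {(p, q). p \<in> (\<rat>::real set) \<and> q \<in> (\<rat>::real set) \<and> p < q}"
      by (rule countable_subset[of _ "\<rat> \<times> \<rat>"]) (auto intro: countable_rat)
    then show "negligible S"
      unfolding S using negligible_two_slopes[OF lip[OF i]]
      by (intro negligible_countable_Union countable_image) auto
  qed
  moreover have "f differentiable (at t)" if "t \<notin> B" for t
    unfolding differentiable_componentwise_within[of f t UNIV]
    using that by (intro ballI differentiable_if_not_two_slopes[OF lip]) (auto simp: B_def)
  ultimately show ?thesis
    by (intro AE_I'[of B]) (auto simp: negligible_iff_null_sets)
qed

lemma lipschitz_imp_abs_cont_on:
  assumes f: "L-lipschitz_on S f"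
  shows "abs_cont_on S f"
  unfolding abs_cont_on_def
proof (intro allI impI)
  fix e :: real assume "0 < e"
  have "0 \<le> L" using f by (rule lipschitz_on_nonneg)
  show "\<exists>\<delta>>0. \<forall>(n::nat) a b. (\<forall>i<n. a i \<le> b i \<and> {a i..b i} \<subseteq> S) \<and>
      disjoint_family_on (\<lambda>i. {a i<..<b i}) {..<n} \<and> (\<Sum>i<n. b i - a i) < \<delta> \<longrightarrow>
      (\<Sum>i<n. norm (f (b i) - f (a i))) < e"
  proof (intro exI[of _ "e / (L + 1)"] conjI allI impI)
    show "0 < e / (L + 1)" using \<open>0 < e\<close> \<open>0 \<le> L\<close> by simp
    fix n :: nat and a b :: "nat \<Rightarrow> real"
    assume *: "(\<forall>i<n. a i \<le> b i \<and> {a i..b i} \<subseteq> S) \<and>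
      disjoint_family_on (\<lambda>i. {a i<..<b i}) {..<n} \<and> (\<Sum>i<n. b i - a i) < e / (L + 1)"
    have "(\<Sum>i<n. norm (f (b i) - f (a i))) \<le> (\<Sum>i<n. L * (b i - a i))"
    proof (rule sum_mono)
      fix i assume "i \<in> {..<n}"
      then have "a i \<le> b i" "{a i..b i} \<subseteq> S" using * by auto
      then have "dist (f (b i)) (f (a i)) \<le> L * dist (b i) (a i)"
        by (intro lipschitz_onD[OF f]) auto
      then show "norm (f (b i) - f (a i)) \<le> L * (b i - a i)"
        using \<open>a i \<le> b i\<close> by (simp add: dist_norm)
    qed
    also have "\<dots> \<le> L * (e / (L + 1))"
      using * \<open>0 \<le> L\<close> by (simp only: flip: sum_distrib_left) (intro mult_left_mono, auto)
    also have "\<dots> < e" using \<open>0 < e\<close> \<open>0 \<le> L\<close> by (simp add: field_simps)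
    finally show "(\<Sum>i<n. norm (f (b i) - f (a i))) < e" .
  qed
qed

section \<open>Limits of asymptotically Lipschitz curves\<close>

text \<open>A version of the Arzela-Ascoli theorem for curves that may jump, as long as the jumps vanish
  in the limit. A diagonal sequence converges at all rational times; as the curves move with speed
  at most \<open>M\<close> up to a small error, convergence on a finite grid of rational times controls them
  on all of \<open>[0, T]\<close>.\<close>
lemma asymptotically_lipschitz_subsequence:
  fixes w :: "nat \<Rightarrow> real \<Rightarrow> 'a::euclidean_space"
  assumes bounded: "\<And>j t. 0 \<le> t \<Longrightarrow> norm (w j t) \<le> R" and "0 \<le> M"
    and lip: "\<And>T e. 0 < e \<Longrightarrow> \<forall>\<^sub>F j in sequentially.
      \<forall>s\<in>{0..T}. \<forall>t\<in>{0..T}. norm (w j s - w j t) \<le> M * \<bar>s - t\<bar> + e"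
  obtains r y where "strict_mono (r :: nat \<Rightarrow> nat)" "M-lipschitz_on {0..} y"
    "\<And>T. uniform_limit {0..T} (\<lambda>j. w (r j)) y sequentially"
proof -
  obtain r where r: "strict_mono (r :: nat \<Rightarrow> nat)"
      "\<And>q. q \<in> \<rat> \<inter> {0..} \<Longrightarrow> \<exists>l. (\<lambda>j. w (r j) q) \<longlonglongrightarrow> l"
    by (rule function_convergent_subsequence[of "\<rat> \<inter> {0..}" w R])
      (use bounded in \<open>auto intro: countable_Int1 countable_rat\<close>)
  have lip_r: "\<forall>\<^sub>F j in sequentially.
      \<forall>s\<in>{0..T}. \<forall>t\<in>{0..T}. norm (w (r j) s - w (r j) t) \<le> M * \<bar>s - t\<bar> + e"
    if "0 < e" for T e
    using eventually_subseq[OF r(1) lip[OF that, of T]] by simp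
  have cauchy: "uniformly_Cauchy_on {0..T} (\<lambda>j. w (r j))" for T
    unfolding uniformly_Cauchy_on_def
  proof (intro allI impI)
    fix e :: real assume "0 < e"
    define \<delta> where "\<delta> = e / (6 * (M + 1))"
    have "0 < \<delta>" using \<open>0 < e\<close> \<open>0 \<le> M\<close> by (simp add: \<delta>_def)
    have M\<delta>: "M * \<delta> \<le> e / 6"
      using \<open>0 < e\<close> \<open>0 \<le> M\<close> by (simp add: \<delta>_def field_simps)
    obtain m where m: "1 / real (Suc m) < \<delta>" using \<open>0 < \<delta>\<close> by (rule nat_approx_posE)
    define h where "h = 1 / real (Suc m)"
    have h: "0 < h" "h < \<delta>" "h \<in> \<rat>" using m by (auto simp: h_def)
    define Q where "Q = (\<lambda>i. real i * h) ` {i. i \<le> nat \<lfloor>T / h\<rfloor>}"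
    have "finite Q" by (simp add: Q_def)
    have Q: "Q \<subseteq> \<rat> \<inter> {0..}" using h by (auto simp: Q_def)
    have near: "\<exists>q\<in>Q. q \<in> {0..T} \<and> \<bar>t - q\<bar> \<le> \<delta>" if t: "t \<in> {0..T}" for t
    proof
      let ?i = "nat \<lfloor>t / h\<rfloor>"
      have i: "real ?i \<le> t / h" "t / h < real ?i + 1"
        using t h by (auto simp: of_nat_nat)
      then have *: "real ?i * h \<le> t" "t < real ?i * h + h"
        using h by (auto simp: field_simps)
      moreover have "0 \<le> real ?i * h" using h by simp
      ultimately have "real ?i * h \<in> {0..T}" "\<bar>t - real ?i * h\<bar> \<le> \<delta>"
        using t h unfolding atLeastAtMost_iff by linarith+
      then show "real ?i * h \<in> {0..T} \<and> \<bar>t - real ?i * h\<bar> \<le> \<delta>" by blast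
      have "t / h \<le> T / h" using t h by (simp add: divide_right_mono)
      then have "?i \<le> nat \<lfloor>T / h\<rfloor>" by (intro nat_mono floor_mono)
      then show "real ?i * h \<in> Q" by (auto simp: Q_def)
    qed
    have "\<forall>q\<in>Q. \<exists>N. \<forall>m\<ge>N. \<forall>n\<ge>N. dist (w (r m) q) (w (r n) q) < e / 6"
    proof
      fix q assume "q \<in> Q"
      then have "Cauchy (\<lambda>j. w (r j) q)" using r(2) Q LIMSEQ_imp_Cauchy by blast
      then show "\<exists>N. \<forall>m\<ge>N. \<forall>n\<ge>N. dist (w (r m) q) (w (r n) q) < e / 6"
        using \<open>0 < e\<close> unfolding Cauchy_def by (metis divide_pos_pos zero_less_numeral)
    qed
    then obtain N where N: "\<And>q m n. q \<in> Q \<Longrightarrow> N q \<le> m \<Longrightarrow> N q \<le> n \<Longrightarrow>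
        dist (w (r m) q) (w (r n) q) < e / 6"
      by metis
    obtain N' where N': "\<And>j s t. N' \<le> j \<Longrightarrow> s \<in> {0..T} \<Longrightarrow> t \<in> {0..T} \<Longrightarrow>
        norm (w (r j) s - w (r j) t) \<le> M * \<bar>s - t\<bar> + e / 6"
      using lip_r[of "e / 6" T] \<open>0 < e\<close> unfolding eventually_sequentially
      by (metis divide_pos_pos zero_less_numeral)
    show "\<exists>N. \<forall>t\<in>{0..T}. \<forall>m\<ge>N. \<forall>n\<ge>N. dist (w (r m) t) (w (r n) t) < e"
    proof (intro exI[of _ "Max (insert N' (N ` Q))"] ballI allI impI)
      fix t m n assume t: "t \<in> {0..T}"
        and mn: "Max (insert N' (N ` Q)) \<le> m" "Max (insert N' (N ` Q)) \<le> n"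
      obtain q where q: "q \<in> Q" "q \<in> {0..T}" "\<bar>t - q\<bar> \<le> \<delta>" using near[OF t] by blast
      have Max: "N' \<le> m" "N q \<le> m" "N' \<le> n" "N q \<le> n"
        using mn q(1) \<open>finite Q\<close> by auto
      have "M * \<bar>t - q\<bar> \<le> e / 6"
        using mult_left_mono[OF q(3) \<open>0 \<le> M\<close>] M\<delta> by linarith
      then have "dist (w (r m) t) (w (r m) q) \<le> e / 3" "dist (w (r n) t) (w (r n) q) \<le> e / 3"
        using N'[OF Max(1) t q(2)] N'[OF Max(3) t q(2)] unfolding dist_norm by linarith+
      moreover have "dist (w (r m) q) (w (r n) q) < e / 6" using N q(1) Max by blast
      moreover have "dist (w (r m) t) (w (r n) t) \<le> dist (w (r m) t) (w (r m) q)
          + dist (w (r m) q) (w (r n) q) + dist (w (r n) t) (w (r n) q)"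
        using dist_triangle[of "w (r m) t" "w (r n) t" "w (r m) q"]
          dist_triangle[of "w (r m) q" "w (r n) t" "w (r n) q"] dist_commute[of "w (r n) t"]
        by auto
      ultimately show "dist (w (r m) t) (w (r n) t) < e" using \<open>0 < e\<close> by linarith
    qed
  qed
  define y where "y = (\<lambda>t. lim (\<lambda>j. w (r j) t))"
  have unif: "uniform_limit {0..T} (\<lambda>j. w (r j)) y sequentially" for T
    using Cauchy_uniformly_convergent[OF cauchy] uniformly_convergent_uniform_limit_iff
    unfolding y_def by blast
  have pw: "(\<lambda>j. w (r j) t) \<longlonglongrightarrow> y t" if "0 \<le> t" for t
    using tendsto_uniform_limitI[OF unif[of t]] that by simp
  have "M-lipschitz_on {0..} y"
  proof (rule lipschitz_onI)
    fix s t :: real assume "s \<in> {0..}" "t \<in> {0..}"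
    then have st: "0 \<le> s" "0 \<le> t" by auto
    have "norm (y s - y t) \<le> M * \<bar>s - t\<bar>"
    proof (rule field_le_epsilon)
      fix e :: real assume "0 < e"
      have "(\<lambda>j. norm (w (r j) s - w (r j) t)) \<longlonglongrightarrow> norm (y s - y t)"
        by (intro tendsto_intros pw st)
      moreover have "\<forall>\<^sub>F j in sequentially. norm (w (r j) s - w (r j) t) \<le> M * \<bar>s - t\<bar> + e"
        using lip_r[OF \<open>0 < e\<close>, of "max s t"] by eventually_elim (use st in auto)
      ultimately show "norm (y s - y t) \<le> M * \<bar>s - t\<bar> + e"
        by (rule tendsto_upperbound) simp
    qed
    then show "dist (y s) (y t) \<le> M * dist s t" by (simp add: dist_norm)
  qed fact
  with r(1) unif show thesis using that by blast
qed

section \<open>Averages along greedily chosen indices\<close>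

text \<open>Let \<open>S\<close> be the sum of the errors \<open>d i - v\<close> over the indices chosen so far. The next index is
  chosen such that its error has inner product at most \<open>1\<close> with \<open>S\<close>. Then the squared norm of \<open>S\<close>
  grows by at most a constant in each step, and the averaged error after \<open>N\<close> steps is of order
  \<open>1 / sqrt N\<close>. The predicate \<open>P\<close> leaves room for a side condition on the \<open>n\<close>-th index.\<close>
lemma greedy_averages:
  fixes d :: "nat \<Rightarrow> 'a::real_inner"
  assumes bounded: "\<And>i. norm (d i - v) \<le> B"
    and choice: "\<And>a n m. \<exists>i\<ge>m. P n i \<and> a \<bullet> (d i - v) \<le> 1"
  obtains \<kappa> where "strict_mono (\<kappa> :: nat \<Rightarrow> nat)" "\<And>n. P n (\<kappa> n)"
    "(\<lambda>N. (1 / real N) *\<^sub>R (\<Sum>j<N. d (\<kappa> j))) \<longlonglongrightarrow> v"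
proof -
  define C where "C = B\<^sup>2 + 2"
  define ok where "ok = (\<lambda>n (s::'a, i). P n i \<and> (norm s)\<^sup>2 \<le> real (Suc n) * C)"
  define step where "step = (\<lambda>(n::nat) (s::'a, i::nat) (s', i'). i < i' \<and> s' = s + (d i' - v))"
  have B: "(norm (d i - v))\<^sup>2 \<le> B\<^sup>2" for i using bounded[of i] by (intro power_mono) auto
  have "\<exists>f. (\<forall>n. ok n (f n)) \<and> (\<forall>n. step n (f n) (f (Suc n))) \<and> fst (f 0) = d (snd (f 0)) - v"
  proof -
    obtain i0 where i0: "P 0 i0" using choice[of 0 0 0] by auto
    have "\<exists>f. \<forall>n. (ok n (f n) \<and> (n = 0 \<longrightarrow> fst (f n) = d (snd (f n)) - v))
        \<and> step n (f n) (f (Suc n))"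
    proof (rule dependent_nat_choice[where
          P = "\<lambda>n p. ok n p \<and> (n = 0 \<longrightarrow> fst p = d (snd p) - v)" and Q = step])
      have "(norm (d i0 - v))\<^sup>2 \<le> C" using B[of i0] by (simp add: C_def)
      then show "\<exists>p. ok 0 p \<and> ((0::nat) = 0 \<longrightarrow> fst p = d (snd p) - v)"
        using i0 by (intro exI[of _ "(d i0 - v, i0)"]) (simp add: ok_def)
    next
      fix p n assume p: "ok n p \<and> (n = 0 \<longrightarrow> fst p = d (snd p) - v)"
      obtain s i where [simp]: "p = (s, i)" by force
      obtain i' where i': "i' \<ge> Suc i" "P (Suc n) i'" "s \<bullet> (d i' - v) \<le> 1"
        using choice[of "Suc i" "Suc n" s] by blast
      have "(norm (s + (d i' - v)))\<^sup>2 = (norm s)\<^sup>2 + 2 * (s \<bullet> (d i' - v)) + (norm (d i' - v))\<^sup>2"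
        by (simp add: power2_norm_eq_inner inner_add_left inner_add_right inner_commute)
      also have "\<dots> \<le> real (Suc n) * C + 2 * 1 + B\<^sup>2"
        using p i'(3) B[of i'] by (intro add_mono mult_left_mono) (auto simp: ok_def)
      also have "\<dots> = real (Suc (Suc n)) * C" by (simp add: C_def algebra_simps)
      finally show "\<exists>q. (ok (Suc n) q \<and> (Suc n = 0 \<longrightarrow> fst q = d (snd q) - v)) \<and> step n p q"
        using i' by (intro exI[of _ "(s + (d i' - v), i')"]) (simp add: ok_def step_def)
    qed
    then show ?thesis by blast
  qed
  then obtain f where f: "\<And>n. ok n (f n)" "\<And>n. step n (f n) (f (Suc n))"
      "fst (f 0) = d (snd (f 0)) - v" by blast
  define \<kappa> where "\<kappa> = (\<lambda>n. snd (f n))"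
  have mono: "strict_mono \<kappa>"
    unfolding strict_mono_Suc_iff using f(2) by (simp add: step_def \<kappa>_def case_prod_beta)
  have P: "P n (\<kappa> n)" for n using f(1)[of n] by (simp add: ok_def \<kappa>_def case_prod_beta)
  have sum: "(\<Sum>j\<le>n. d (\<kappa> j) - v) = fst (f n)" for n
  proof (induction n)
    case 0
    then show ?case using f(3) by (simp add: \<kappa>_def)
  next
    case (Suc n)
    then show ?case using f(2)[of n] by (simp add: step_def \<kappa>_def case_prod_beta)
  qed
  have "(\<lambda>N. (1 / real N) *\<^sub>R (\<Sum>j<N. d (\<kappa> j)) - v) \<longlonglongrightarrow> 0"
  proof (rule Lim_null_comparison)
    show "(\<lambda>N. sqrt (C / real N)) \<longlonglongrightarrow> 0"
      using tendsto_real_sqrt[OF lim_const_over_n[of C]] by simp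
    show "\<forall>\<^sub>F N in sequentially.
        norm ((1 / real N) *\<^sub>R (\<Sum>j<N. d (\<kappa> j)) - v) \<le> sqrt (C / real N)"
      using eventually_gt_at_top[of 0]
    proof eventually_elim
      case (elim N)
      then obtain n where N: "N = Suc n" using gr0_implies_Suc by blast
      have "(1 / real N) *\<^sub>R (\<Sum>j<N. d (\<kappa> j)) - v = (1 / real N) *\<^sub>R (\<Sum>j\<le>n. d (\<kappa> j) - v)"
        using elim by (simp add: N sum_subtractf lessThan_Suc_atMost scaleR_diff_right
            sum_constant_scaleR del: of_nat_Suc)
      also have "norm \<dots> = (1 / real N) * norm (fst (f n))" by (simp add: sum)
      finally have "(norm ((1 / real N) *\<^sub>R (\<Sum>j<N. d (\<kappa> j)) - v))\<^sup>2
          = (1 / real N)\<^sup>2 * (norm (fst (f n)))\<^sup>2" by (simp only: power_mult_distrib)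
      also have "\<dots> \<le> (1 / real N)\<^sup>2 * (real N * C)"
        using f(1)[of n] by (intro mult_left_mono) (simp_all add: ok_def N case_prod_beta)
      also have "\<dots> = C / real N" using elim by (simp add: power2_eq_square)
      finally show ?case by (rule real_le_rsqrt)
    qed
  qed
  then have "(\<lambda>N. (1 / real N) *\<^sub>R (\<Sum>j<N. d (\<kappa> j))) \<longlonglongrightarrow> v" by (simp add: LIM_zero_iff)
  with mono P show thesis by (rule that)
qed

section \<open>Gradients of strictly convex functions\<close>

lemma gderiv_grad: "GDERIV f x :> D \<Longrightarrow> GDERIV f x :> grad f x"
proof -
  assume D: "GDERIV f x :> D"
  have "E = D" if "GDERIV f x :> E" for E
  proof -
    have "(\<lambda>h. h \<bullet> E) = (\<lambda>h. h \<bullet> D)"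
      using that D unfolding gderiv_def by (rule has_derivative_unique)
    then have "(E - D) \<bullet> E = (E - D) \<bullet> D" by (rule fun_cong)
    then have "(E - D) \<bullet> (E - D) = 0" by (simp add: inner_diff_right)
    then show "E = D" by simp
  qed
  with D show "GDERIV f x :> grad f x" unfolding grad_def by (rule theI)
qed

lemma strictly_convex_above_tangent:
  fixes f :: "'a::real_inner \<Rightarrow> real"
  assumes f: "strictly_convex f" and D: "GDERIV f u :> p"
  shows "p \<bullet> (v - u) \<le> f v - f u"
proof (cases "u = v")
  case False
  define g where "g = (\<lambda>s. f (u + s *\<^sub>R (v - u)))"
  have "((\<lambda>s. u + s *\<^sub>R (v - u)) has_derivative (\<lambda>s. s *\<^sub>R (v - u))) (at 0)"
    by (auto intro!: derivative_eq_intros)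
  moreover have "(f has_derivative (\<lambda>h. h \<bullet> p)) (at (u + 0 *\<^sub>R (v - u)))"
    using D by (simp add: gderiv_def)
  ultimately have "(g has_derivative (\<lambda>s. (s *\<^sub>R (v - u)) \<bullet> p)) (at 0)"
    unfolding g_def by (rule has_derivative_compose)
  then have "(g has_real_derivative p \<bullet> (v - u)) (at 0)"
    by (rule has_derivative_imp_has_field_derivative) (simp add: inner_commute)
  then have "((\<lambda>s. (g s - g 0) / s) \<longlongrightarrow> p \<bullet> (v - u)) (at 0)"
    by (simp add: has_field_derivative_iff)
  then have "((\<lambda>s. (g s - g 0) / s) \<longlongrightarrow> p \<bullet> (v - u)) (at_right 0)"
    by (rule tendsto_within_subset) simp
  moreover have "\<forall>\<^sub>F s in at_right 0. (g s - g 0) / s \<le> f v - f u"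
    unfolding eventually_at_right_field
  proof (intro exI[of _ 1] conjI allI impI)
    fix s :: real assume s: "0 < s" "s < 1"
    have "g s = f ((1 - s) *\<^sub>R u + s *\<^sub>R v)" by (simp add: g_def algebra_simps)
    also have "\<dots> < (1 - s) * f u + s * f v"
      using f False s unfolding strictly_convex_def by blast
    finally have "g s - g 0 \<le> (f v - f u) * s" by (simp add: g_def algebra_simps)
    then show "(g s - g 0) / s \<le> f v - f u" using s by (simp add: divide_le_eq)
  qed simp
  ultimately show ?thesis by (rule tendsto_upperbound) simp
qed simp

text \<open>If two points have the same gradient, the tangent inequalities at both of them force \<open>f\<close> to
  be affine on the segment between them, against strict convexity at the midpoint.\<close>
lemma strictly_convex_inj_grad:
  fixes f :: "'a::real_inner \<Rightarrow> real"
  assumes f: "strictly_convex f" and D: "\<And>x. GDERIV f x :> grad f x"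
  shows "inj (grad f)"
proof (rule injI, rule ccontr)
  fix u v assume eq: "grad f u = grad f v" and "u \<noteq> v"
  let ?m = "(1 - 1 / 2) *\<^sub>R u + (1 / 2) *\<^sub>R v"
  have "f ?m < (1 - 1 / 2) * f u + (1 / 2) * f v"
    using f \<open>u \<noteq> v\<close> unfolding strictly_convex_def
    by (elim allE[of _ u] allE[of _ v] allE[of _ "1/2"]) simp
  moreover have "grad f u \<bullet> (?m - u) \<le> f ?m - f u"
    using f D by (rule strictly_convex_above_tangent)
  moreover have "grad f v \<bullet> (u - v) \<le> f u - f v"
    using f D by (rule strictly_convex_above_tangent)
  moreover have "grad f u \<bullet> (?m - u) = - (grad f v \<bullet> (u - v)) / 2"
  proof -
    have "?m - u = (- 1 / 2) *\<^sub>R (u - v)" by (simp add: algebra_simps flip: scaleR_add_left)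
    then show ?thesis by (simp add: eq)
  qed
  ultimately show False by simp
qed

section \<open>The iterates in continuous time\<close>

text \<open>The kernel enters through \<open>grad \<phi>\<close> as a continuous injection, which is a homeomorphism on the
  compact closure of the iterates.\<close>
locale averaged_inclusion_scheme =
  fixes \<phi> :: "'a::euclidean_space \<Rightarrow> real" and H :: "'a \<Rightarrow> 'a set"
    and \<eta> :: "nat \<Rightarrow> real" and x d \<xi> :: "nat \<Rightarrow> 'a"
  assumes eta_pos: "\<And>k. 0 < \<eta> k"
    and update: "\<And>k. grad \<phi> (x (Suc k)) = grad \<phi> (x k) - \<eta> k *\<^sub>R (d k + \<xi> k)"
    and inj_grad: "inj (grad \<phi>)" and cont_grad: "continuous_on UNIV (grad \<phi>)"
    and bounded_x: "bounded (range x)" and bounded_d: "bounded (range d)"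
    and eta_sum: "filterlim (\<lambda>n. \<Sum>k<n. \<eta> k) at_top sequentially"
    and eta_lim: "\<eta> \<longlonglongrightarrow> 0"
    and noise: "\<And>T. T > 0 \<Longrightarrow>
      (\<lambda>s. SUP i\<in>{s..step_index \<eta> (step_time \<eta> s + T)}. norm (\<Sum>k=s..i. \<eta> k *\<^sub>R \<xi> k))
        \<longlonglongrightarrow> 0"
    and closed_H: "\<And>u. closed (H u)"
    and averages: "\<And>(\<kappa>::nat \<Rightarrow> nat) u. strict_mono \<kappa> \<Longrightarrow> (\<lambda>j. x (\<kappa> j)) \<longlonglongrightarrow> u \<Longrightarrow>
      (\<lambda>N. edist_set ((1 / real N) *\<^sub>R (\<Sum>j<N. d (\<kappa> j))) (H u)) \<longlonglongrightarrow> 0"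
begin

lemma step_time_Suc: "step_time \<eta> (Suc k) = step_time \<eta> k + \<eta> k"
  by (simp add: step_time_def)

lemma step_time_nonneg: "0 \<le> step_time \<eta> k"
  unfolding step_time_def by (intro sum_nonneg less_imp_le eta_pos)

lemma strict_mono_step_time: "strict_mono (step_time \<eta>)"
  by (simp add: strict_mono_Suc_iff step_time_Suc eta_pos)

lemma step_time_le_iff: "step_time \<eta> i \<le> step_time \<eta> k \<longleftrightarrow> i \<le> k"
  using strict_mono_step_time by (rule strict_mono_less_eq)

lemma le_step_index_iff:
  assumes "0 \<le> t"
  shows "k \<le> step_index \<eta> t \<longleftrightarrow> step_time \<eta> k \<le> t"
proof -
  let ?A = "{k. step_time \<eta> k \<le> t}"
  have "\<forall>\<^sub>F n in sequentially. t < (\<Sum>k<n. \<eta> k)"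
    using eta_sum by (simp add: filterlim_at_top_dense)
  then obtain n where n: "t < step_time \<eta> n"
    unfolding step_time_def by (metis eventually_happens sequentially_bot)
  have "?A \<subseteq> {..n}"
  proof
    fix k assume "k \<in> ?A"
    then have "step_time \<eta> k \<le> step_time \<eta> n" using n by simp
    then show "k \<in> {..n}" using step_time_le_iff by simp
  qed
  then have fin: "finite ?A" by (rule finite_subset) simp
  have "0 \<in> ?A" using assms by (simp add: step_time_def)
  then have Sup: "step_index \<eta> t = Max ?A"
    unfolding step_index_def using fin by (intro cSup_eq_Max) auto
  have "Max ?A \<in> ?A" using fin \<open>0 \<in> ?A\<close> by (intro Max_in) auto
  then have "step_time \<eta> k \<le> t" if "k \<le> Max ?A"
    using that step_time_le_iff[of k "Max ?A"] by auto
  moreover have "k \<le> Max ?A" if "step_time \<eta> k \<le> t"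
    using fin that by (intro Max_ge) auto
  ultimately show ?thesis unfolding Sup by blast
qed

text \<open>The last step reached when the time \<open>t\<close> has elapsed after step \<open>m\<close>. The curve
  \<open>t \<mapsto> x (current m t)\<close> is the piecewise constant interpolation of the iterates, shifted so that
  step \<open>m\<close> happens at time \<open>0\<close>.\<close>
definition current :: "nat \<Rightarrow> real \<Rightarrow> nat" where
  "current m t = step_index \<eta> (step_time \<eta> m + t)"

lemma le_current_iff: "0 \<le> t \<Longrightarrow> k \<le> current m t \<longleftrightarrow> step_time \<eta> k \<le> step_time \<eta> m + t"
  unfolding current_def using step_time_nonneg[of m] by (intro le_step_index_iff) simp

lemma le_current: "0 \<le> t \<Longrightarrow> m \<le> current m t"
  by (simp add: le_current_iff)

lemma step_time_current_le: "0 \<le> t \<Longrightarrow> step_time \<eta> (current m t) \<le> step_time \<eta> m + t"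
  using le_current_iff[of t "current m t" m] by simp

lemma less_step_time_current:
  "0 \<le> t \<Longrightarrow> step_time \<eta> m + t < step_time \<eta> (current m t) + \<eta> (current m t)"
  using le_current_iff[of t "Suc (current m t)" m] by (simp add: step_time_Suc)

lemma current_mono: "0 \<le> s \<Longrightarrow> s \<le> t \<Longrightarrow> current m s \<le> current m t"
  using step_time_current_le[of s m] by (simp add: le_current_iff)

lemma current_step_time:
  assumes "m \<le> k"
  shows "current m (step_time \<eta> k - step_time \<eta> m) = k"
proof -
  have "0 \<le> step_time \<eta> k - step_time \<eta> m" using assms step_time_le_iff by simp
  then have "i \<le> current m (step_time \<eta> k - step_time \<eta> m) \<longleftrightarrow> i \<le> k" for i
    by (simp add: le_current_iff step_time_le_iff)
  then show ?thesis by (meson order_antisym order_refl)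
qed

lemma current_0: "current m 0 = m"
  using current_step_time[of m m] by simp

text \<open>Transfers estimates that are uniform in time to every single iterate of a window.\<close>
lemma current_intermediate:
  assumes "0 \<le> s" "s \<le> t" "current m s \<le> k" "k \<le> current m t"
  obtains u where "s \<le> u" "u \<le> t" "current m u = k"
proof (cases "current m s = k")
  case True
  then show thesis using that[of s] assms(2) by simp
next
  case False
  define u where "u = step_time \<eta> k - step_time \<eta> m"
  have "m \<le> k" using le_current[OF assms(1), of m] assms(3) by simp
  have "\<not> k \<le> current m s" using False assms(3) by simp
  then have "s \<le> u" using le_current_iff[OF assms(1)] by (simp add: u_def)
  moreover have "u \<le> t" using assms le_current_iff[of t k m] by (simp add: u_def)
  moreover have "current m u = k" unfolding u_def using \<open>m \<le> k\<close> by (rule current_step_time)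
  ultimately show thesis by (rule that)
qed

lemma tendsto_elapsed_time:
  assumes \<mu>: "filterlim \<mu> at_top sequentially" and "0 \<le> t"
  shows "(\<lambda>j. step_time \<eta> (current (\<mu> j) t) - step_time \<eta> (\<mu> j)) \<longlonglongrightarrow> t"
proof -
  have "filterlim (\<lambda>j. current (\<mu> j) t) at_top sequentially"
    using \<mu> by (rule filterlim_at_top_mono) (simp add: le_current \<open>0 \<le> t\<close>)
  then have \<eta>: "(\<lambda>j. \<eta> (current (\<mu> j) t)) \<longlonglongrightarrow> 0" by (rule filterlim_compose[OF eta_lim])
  show ?thesis
  proof (rule tendsto_sandwich)
    show "\<forall>\<^sub>F j in sequentially.
        t - \<eta> (current (\<mu> j) t) \<le> step_time \<eta> (current (\<mu> j) t) - step_time \<eta> (\<mu> j)"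
      using less_step_time_current[OF \<open>0 \<le> t\<close>]
      by (intro always_eventually allI) (smt (verit, best))
    show "\<forall>\<^sub>F j in sequentially. step_time \<eta> (current (\<mu> j) t) - step_time \<eta> (\<mu> j) \<le> t"
      using step_time_current_le[OF \<open>0 \<le> t\<close>]
      by (intro always_eventually allI) (smt (verit, best))
    show "(\<lambda>j. t - \<eta> (current (\<mu> j) t)) \<longlonglongrightarrow> t" using tendsto_diff[OF tendsto_const \<eta>] by simp
  qed simp
qed

lemma eventually_noise_small:
  assumes "0 < e"
  shows "\<forall>\<^sub>F p in sequentially. \<forall>q. step_time \<eta> q \<le> step_time \<eta> p + T \<longrightarrow>
    norm (\<Sum>k\<in>{p..<q}. \<eta> k *\<^sub>R \<xi> k) \<le> e"
proof -
  define T' where "T' = max T 1"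
  have "0 < T'" by (simp add: T'_def)
  let ?n = "\<lambda>p i. norm (\<Sum>k=p..i. \<eta> k *\<^sub>R \<xi> k)"
  have "\<forall>\<^sub>F p in sequentially. (SUP i\<in>{p..current p T'}. ?n p i) < e"
    using noise[OF \<open>0 < T'\<close>] \<open>0 < e\<close> unfolding current_def by (rule order_tendstoD(2))
  then show ?thesis
  proof eventually_elim
    case (elim p)
    show ?case
    proof (intro allI impI)
      fix q assume q: "step_time \<eta> q \<le> step_time \<eta> p + T"
      show "norm (\<Sum>k\<in>{p..<q}. \<eta> k *\<^sub>R \<xi> k) \<le> e"
      proof (cases "p < q")
        case True
        then obtain i where i: "q = Suc i" "p \<le> i" by (cases q) auto
        have "step_time \<eta> i \<le> step_time \<eta> p + T'"
          using q eta_pos[of i] by (simp add: i(1) step_time_Suc T'_def)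
        then have "i \<in> {p..current p T'}"
          using i(2) \<open>0 < T'\<close> by (simp add: le_current_iff)
        then have "?n p i \<le> (SUP i\<in>{p..current p T'}. ?n p i)"
          by (intro cSUP_upper) auto
        with elim show ?thesis by (simp add: i(1) atLeastLessThanSuc_atLeastAtMost)
      qed (use \<open>0 < e\<close> in simp)
    qed
  qed
qed

lemma sum_eta_eq: "p \<le> q \<Longrightarrow> (\<Sum>k\<in>{p..<q}. \<eta> k) = step_time \<eta> q - step_time \<eta> p"
  by (induction q rule: dec_induct) (auto simp: step_time_Suc)

lemma grad_increment:
  "p \<le> q \<Longrightarrow> grad \<phi> (x q) - grad \<phi> (x p) =
     - (\<Sum>k\<in>{p..<q}. \<eta> k *\<^sub>R d k) - (\<Sum>k\<in>{p..<q}. \<eta> k *\<^sub>R \<xi> k)"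
  by (induction q rule: dec_induct) (auto simp: update algebra_simps)

text \<open>Between two times the directions \<open>d\<close> contribute at most \<open>D\<close> times the step time between the
  corresponding steps. That step time differs from \<open>\<bar>s - t\<bar>\<close> by no more than one step size; this
  and the noise are absorbed by \<open>e\<close>.\<close>
lemma asymptotically_lipschitz:
  assumes D: "\<And>k. norm (d k) \<le> D" and "0 < e"
  shows "\<forall>\<^sub>F m in sequentially. \<forall>s\<in>{0..T}. \<forall>t\<in>{0..T}.
    norm (grad \<phi> (x (current m s)) - grad \<phi> (x (current m t))) \<le> D * \<bar>s - t\<bar> + e"
proof -
  have "0 \<le> D" using D[of 0] norm_ge_zero order_trans by blast
  \<comment> \<open>Steps below \<open>c\<close> cost at most \<open>e / 2\<close>, and at most one unit of time in the noise window.\<close>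
  define c where "c = min 1 (e / (2 * (D + 1)))"
  have "0 < c" using \<open>0 < e\<close> \<open>0 \<le> D\<close> by (simp add: c_def)
  have Dc: "D * c \<le> e / 2"
  proof -
    have "D * c \<le> D * (e / (2 * (D + 1)))" using \<open>0 \<le> D\<close> by (intro mult_left_mono) (simp_all add: c_def)
    also have "\<dots> \<le> e / 2" using \<open>0 \<le> D\<close> \<open>0 < e\<close> by (simp add: field_simps)
    finally show ?thesis .
  qed
  have "\<forall>\<^sub>F p in sequentially. \<eta> p < c \<and> (\<forall>q. step_time \<eta> q \<le> step_time \<eta> p + (T + 1) \<longrightarrow>
      norm (\<Sum>k\<in>{p..<q}. \<eta> k *\<^sub>R \<xi> k) \<le> e / 2)"
    using order_tendstoD(2)[OF eta_lim \<open>0 < c\<close>] eventually_noise_small[of "e / 2" "T + 1"] \<open>0 < e\<close>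
    by (intro eventually_conj) auto
  then obtain m0 where m0: "\<And>p. m0 \<le> p \<Longrightarrow> \<eta> p < c"
      "\<And>p q. m0 \<le> p \<Longrightarrow> step_time \<eta> q \<le> step_time \<eta> p + (T + 1) \<Longrightarrow>
        norm (\<Sum>k\<in>{p..<q}. \<eta> k *\<^sub>R \<xi> k) \<le> e / 2"
    unfolding eventually_sequentially by blast
  have ordered: "norm (grad \<phi> (x (current m t)) - grad \<phi> (x (current m s))) \<le> D * (t - s) + e"
    if m: "m0 \<le> m" and st: "0 \<le> s" "s \<le> t" "t \<le> T" for m s t
  proof -
    let ?p = "current m s" and ?q = "current m t"
    have pq: "?p \<le> ?q" and p: "m0 \<le> ?p"
      using current_mono[OF st(1,2)] le_current[OF st(1), of m] m by auto
    have gap: "step_time \<eta> ?q - step_time \<eta> ?p \<le> t - s + \<eta> ?p"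
      using step_time_current_le[of t m] less_step_time_current[of s m] st by auto
    have "\<eta> ?p < c" "c \<le> 1" using m0(1)[OF p] by (auto simp: c_def)
    then have "norm (\<Sum>k\<in>{?p..<?q}. \<eta> k *\<^sub>R \<xi> k) \<le> e / 2"
      using gap st by (intro m0(2)[OF p]) linarith
    moreover have "norm (\<Sum>k\<in>{?p..<?q}. \<eta> k *\<^sub>R d k) \<le> D * (t - s) + e / 2"
    proof -
      have "norm (\<Sum>k\<in>{?p..<?q}. \<eta> k *\<^sub>R d k) \<le> (\<Sum>k\<in>{?p..<?q}. \<eta> k * D)"
        using D eta_pos by (intro sum_norm_le) (simp add: less_imp_le)
      also have "\<dots> = D * (step_time \<eta> ?q - step_time \<eta> ?p)"
        by (simp only: sum_eta_eq[OF pq, symmetric] sum_distrib_left mult.commute)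
      also have "\<dots> \<le> D * (t - s + c)"
        using gap \<open>\<eta> ?p < c\<close> \<open>0 \<le> D\<close> by (intro mult_left_mono) auto
      finally show ?thesis using Dc by (simp add: distrib_left)
    qed
    ultimately show ?thesis
      unfolding grad_increment[OF pq]
      using norm_triangle_ineq4[of "- (\<Sum>k\<in>{?p..<?q}. \<eta> k *\<^sub>R d k)" "\<Sum>k\<in>{?p..<?q}. \<eta> k *\<^sub>R \<xi> k"]
      by simp
  qed
  show ?thesis
    unfolding eventually_sequentially
  proof (intro exI[of _ m0] allI impI ballI)
    fix m s t assume "m0 \<le> m" "s \<in> {0..T}" "t \<in> {0..T}"
    then show "norm (grad \<phi> (x (current m s)) - grad \<phi> (x (current m t))) \<le> D * \<bar>s - t\<bar> + e"
      using ordered[of m s t] ordered[of m t s]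
      by (cases "s \<le> t") (auto simp: norm_minus_commute)
  qed
qed

text \<open>The hypothesis says that no linear functional strictly separates \<open>v\<close> from the directions
  \<open>d i\<close> at late iterates near \<open>u\<close>. This is what the greedy choice of indices needs, and
  requiring \<open>x i\<close> to be ever closer to \<open>u\<close> makes the averaging condition on \<open>H\<close> applicable.\<close>
lemma limit_direction_in_H:
  assumes near: "\<And>a e m. 0 < e \<Longrightarrow> \<exists>i\<ge>m. dist (x i) u < e \<and> a \<bullet> (d i - v) \<le> e"
  shows "v \<in> H u"
proof -
  obtain D where D: "\<And>i. norm (d i) \<le> D" using bounded_d unfolding bounded_iff by blast
  obtain \<kappa> where \<kappa>: "strict_mono (\<kappa> :: nat \<Rightarrow> nat)"
      "\<And>n. dist (x (\<kappa> n)) u < 1 / real (Suc n)"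
      "(\<lambda>N. (1 / real N) *\<^sub>R (\<Sum>j<N. d (\<kappa> j))) \<longlonglongrightarrow> v"
  proof (rule greedy_averages[of d v "D + norm v" "\<lambda>n i. dist (x i) u < 1 / real (Suc n)"])
    show "norm (d i - v) \<le> D + norm v" for i
      using norm_triangle_ineq4[of "d i" v] D[of i] by linarith
    show "\<exists>i\<ge>m. dist (x i) u < 1 / real (Suc n) \<and> a \<bullet> (d i - v) \<le> 1" for a n m
    proof -
      obtain i where "m \<le> i" "dist (x i) u < 1 / real (Suc n)" "a \<bullet> (d i - v) \<le> 1 / real (Suc n)"
        using near[of "1 / real (Suc n)" m a] by auto
      moreover have "1 / real (Suc n) \<le> 1" by simp
      ultimately show ?thesis by (meson order_trans)
    qed
  qed blast
  have "(\<lambda>n. dist (x (\<kappa> n)) u) \<longlonglongrightarrow> 0"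
    by (rule tendsto_sandwich[OF _ _ tendsto_const LIMSEQ_inverse_real_of_nat])
      (use \<kappa>(2) in \<open>auto intro!: always_eventually less_imp_le simp: inverse_eq_divide\<close>)
  then have "(\<lambda>n. x (\<kappa> n)) \<longlonglongrightarrow> u" by (rule tendsto_dist_iff[THEN iffD2])
  note avg = averages[OF \<kappa>(1) this]
  have "\<exists>w\<in>H u. dist w v < e" if "0 < e" for e
  proof -
    have "\<forall>\<^sub>F N in sequentially.
        edist_set ((1 / real N) *\<^sub>R (\<Sum>j<N. d (\<kappa> j))) (H u) < ereal (e / 2)"
      using avg by (rule order_tendstoD(2)) (use \<open>0 < e\<close> in simp)
    moreover have "\<forall>\<^sub>F N in sequentially. dist ((1 / real N) *\<^sub>R (\<Sum>j<N. d (\<kappa> j))) v < e / 2"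
      using \<kappa>(3) by (rule tendstoD) (use \<open>0 < e\<close> in simp)
    ultimately have "\<forall>\<^sub>F N in sequentially. \<exists>w\<in>H u. dist w v < e"
    proof eventually_elim
      case (elim N)
      let ?s = "(1 / real N) *\<^sub>R (\<Sum>j<N. d (\<kappa> j))"
      obtain w where "w \<in> H u" "norm (?s - w) < e / 2"
        using elim(1) unfolding edist_set_def INF_less_iff by auto
      moreover have "dist w v \<le> dist ?s w + dist ?s v"
        using dist_triangle[of w v ?s] by (simp add: dist_commute)
      ultimately show ?case using elim(2) by (intro bexI[of _ w]) (auto simp: dist_norm)
    qed
    then show ?thesis by simp
  qed
  then have "v \<in> closure (H u)" by (simp add: closure_approachable)
  then show ?thesis using closed_H by simp
qed
section \<open>Limit trajectories\<close>

text \<open>Otherwise some functional \<open>a\<close> has \<open>a \<bullet> d i > e - a \<bullet> v\<close> at all late iterates near \<open>z t\<close>. Over a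
  short window \<open>[t, t + h]\<close> all iterates are of this kind, so \<open>a \<bullet> grad \<phi> (x i)\<close> drops over it by about
  \<open>(e - a \<bullet> v) h\<close> or more. In the limit this contradicts the difference quotient \<open>v\<close>.\<close>
lemma limit_velocity_in_H:
  assumes \<mu>: "filterlim \<mu> at_top sequentially" and t: "0 \<le> t" "t < T"
    and unif: "uniform_limit {0..T} (\<lambda>j s. x (current (\<mu> j) s)) z sequentially"
    and cont: "continuous_on {0..} z"
    and deriv: "((\<lambda>s. grad \<phi> (z s)) has_vector_derivative v) (at t within {0..})"
  shows "- v \<in> H (z t)"
proof (rule limit_direction_in_H, rule ccontr)
  fix a :: 'a and e :: real and m0 :: nat
  assume "0 < e" and contra: "\<not> (\<exists>i\<ge>m0. dist (x i) (z t) < e \<and> a \<bullet> (d i - - v) \<le> e)"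
  have far: "e - a \<bullet> v \<le> a \<bullet> d i" if "m0 \<le> i" "dist (x i) (z t) < e" for i
  proof -
    have "\<not> a \<bullet> (d i - - v) \<le> e" using contra that by blast
    then show ?thesis by (simp add: inner_add_right)
  qed
  let ?y = "\<lambda>s. grad \<phi> (z s)"
  \<comment> \<open>With this \<open>c\<close>, the noise and the error of the difference quotient cost at most \<open>e h / 4\<close> each.\<close>
  define c where "c = e / (4 * (norm a + 1))"
  have na: "0 < norm a + 1" using norm_ge_zero[of a] by linarith
  then have "0 < c" using \<open>0 < e\<close> by (simp add: c_def)
  have ac: "norm a * c \<le> e / 4"
    using \<open>0 < e\<close> na by (simp add: c_def field_simps)
  obtain \<delta>1 where \<delta>1: "0 < \<delta>1" "\<And>s. 0 \<le> s \<Longrightarrow> dist s t < \<delta>1 \<Longrightarrow> dist (z s) (z t) < e / 2"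
    using cont t(1) \<open>0 < e\<close> unfolding continuous_on_iff
    by (metis atLeast_iff half_gt_zero)
  obtain \<delta>2 where \<delta>2: "0 < \<delta>2" "\<And>s. 0 \<le> s \<Longrightarrow> norm (s - t) < \<delta>2 \<Longrightarrow>
      norm (?y s - ?y t - (s - t) *\<^sub>R v) \<le> c * norm (s - t)"
    using deriv \<open>0 < c\<close> unfolding has_vector_derivative_def has_derivative_within_alt
    by (metis atLeast_iff)
  define h where "h = min (min \<delta>1 \<delta>2) (T - t) / 2"
  have h: "0 < h" "h < \<delta>1" "h < \<delta>2" "t + h \<le> T"
    using \<delta>1(1) \<delta>2(1) t by (auto simp: h_def min_def field_simps)
  define p q where "p = (\<lambda>j. current (\<mu> j) t)" and "q = (\<lambda>j. current (\<mu> j) (t + h))"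
  have pq: "\<mu> j \<le> p j" "p j \<le> q j" for j
    using t h by (auto simp: p_def q_def le_current intro!: current_mono)
  have p: "filterlim p at_top sequentially"
    using \<mu> by (rule filterlim_at_top_mono) (simp add: pq)
  have gap: "(\<lambda>j. step_time \<eta> (q j) - step_time \<eta> (p j)) \<longlonglongrightarrow> h"
    using tendsto_diff[OF tendsto_elapsed_time[OF \<mu>, of "t + h"] tendsto_elapsed_time[OF \<mu> t(1)]]
      t h by (simp add: p_def q_def)
  have conv: "(\<lambda>j. grad \<phi> (x (current (\<mu> j) s))) \<longlonglongrightarrow> ?y s" if "s \<in> {0..T}" for s
    by (rule continuous_on_tendsto_compose[OF cont_grad tendsto_uniform_limitI[OF unif that]]) auto
  have "(\<lambda>j. a \<bullet> (grad \<phi> (x (q j)) - grad \<phi> (x (p j)))) \<longlonglongrightarrow> a \<bullet> (?y (t + h) - ?y t)"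
    unfolding p_def q_def using t h by (intro tendsto_intros conv) auto
  moreover have "(\<lambda>j. - (e - a \<bullet> v) * (step_time \<eta> (q j) - step_time \<eta> (p j)) + norm a * (c * h))
      \<longlonglongrightarrow> - (e - a \<bullet> v) * h + norm a * (c * h)"
    by (intro tendsto_intros gap)
  moreover have "\<forall>\<^sub>F j in sequentially. a \<bullet> (grad \<phi> (x (q j)) - grad \<phi> (x (p j)))
      \<le> - (e - a \<bullet> v) * (step_time \<eta> (q j) - step_time \<eta> (p j)) + norm a * (c * h)"
  proof -
    have "\<forall>\<^sub>F j in sequentially. \<forall>s\<in>{0..T}. dist (x (current (\<mu> j) s)) (z s) < e / 2"
      using unif half_gt_zero[OF \<open>0 < e\<close>] unfolding uniform_limit_iff by blast
    moreover have "\<forall>\<^sub>F j in sequentially. m0 \<le> \<mu> j"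
      using \<mu> by (simp add: filterlim_at_top)
    moreover have "\<forall>\<^sub>F j in sequentially. step_time \<eta> (q j) - step_time \<eta> (p j) < h + 1"
      using gap by (rule order_tendstoD(2)) simp
    moreover have "\<forall>\<^sub>F j in sequentially. \<forall>r. step_time \<eta> r \<le> step_time \<eta> (p j) + (h + 1) \<longrightarrow>
        norm (\<Sum>k\<in>{p j..<r}. \<eta> k *\<^sub>R \<xi> k) \<le> c * h"
      using eventually_noise_small[of "c * h" "h + 1"] \<open>0 < c\<close> h(1)
      by (intro eventually_compose_filterlim[OF _ p]) simp
    ultimately show ?thesis
    proof eventually_elim
      case (elim j)
      have d: "e - a \<bullet> v \<le> a \<bullet> d k" if k: "k \<in> {p j..<q j}" for k
      proof (rule far)
        show "m0 \<le> k" using elim(2) pq(1)[of j] k by simp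
        obtain s where s: "t \<le> s" "s \<le> t + h" "current (\<mu> j) s = k"
          using current_intermediate[of t "t + h" "\<mu> j" k] k t h by (auto simp: p_def q_def)
        have "dist (x k) (z s) < e / 2" using elim(1) s t h by auto
        moreover have "dist (z s) (z t) < e / 2"
          using s t h by (intro \<delta>1(2)) (auto simp: dist_real_def)
        ultimately show "dist (x k) (z t) < e" using dist_triangle[of "x k" "z t" "z s"] by linarith
      qed
      have "(e - a \<bullet> v) * (step_time \<eta> (q j) - step_time \<eta> (p j))
          = (\<Sum>k\<in>{p j..<q j}. \<eta> k * (e - a \<bullet> v))"
        by (simp only: sum_eta_eq[OF pq(2), symmetric] sum_distrib_left sum_distrib_right mult.commute)
      also have "\<dots> \<le> (\<Sum>k\<in>{p j..<q j}. \<eta> k * (a \<bullet> d k))"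
        using d eta_pos by (intro sum_mono mult_left_mono) (auto intro: less_imp_le)
      finally have "(e - a \<bullet> v) * (step_time \<eta> (q j) - step_time \<eta> (p j))
          \<le> a \<bullet> (\<Sum>k\<in>{p j..<q j}. \<eta> k *\<^sub>R d k)" by (simp add: inner_sum_right)
      moreover have "- (a \<bullet> (\<Sum>k\<in>{p j..<q j}. \<eta> k *\<^sub>R \<xi> k)) \<le> norm a * (c * h)"
      proof -
        have "norm (\<Sum>k\<in>{p j..<q j}. \<eta> k *\<^sub>R \<xi> k) \<le> c * h" using elim(3,4) by simp
        then have "norm a * norm (\<Sum>k\<in>{p j..<q j}. \<eta> k *\<^sub>R \<xi> k) \<le> norm a * (c * h)"
          by (rule mult_left_mono) simp
        then show ?thesis
          using Cauchy_Schwarz_ineq2[of a "\<Sum>k\<in>{p j..<q j}. \<eta> k *\<^sub>R \<xi> k"] by linarith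
      qed
      ultimately show ?case
        unfolding grad_increment[OF pq(2)] inner_diff_right inner_minus_right by linarith
    qed
  qed
  ultimately have "a \<bullet> (?y (t + h) - ?y t) \<le> - (e - a \<bullet> v) * h + norm a * (c * h)"
    by (intro tendsto_le[OF sequentially_bot])
  moreover have "h * (a \<bullet> v) - norm a * (c * h) \<le> a \<bullet> (?y (t + h) - ?y t)"
  proof -
    let ?r = "?y (t + h) - ?y t - h *\<^sub>R v"
    have "norm ?r \<le> c * h" using \<delta>2(2)[of "t + h"] t h by simp
    then have "norm a * norm ?r \<le> norm a * (c * h)" by (rule mult_left_mono) simp
    then have "- (norm a * (c * h)) \<le> a \<bullet> ?r"
      using Cauchy_Schwarz_ineq2[of a ?r] by linarith
    then show ?thesis by (simp add: inner_diff_right)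
  qed
  moreover have "norm a * (c * h) \<le> e / 4 * h"
    using mult_right_mono[OF ac, of h] h(1) by (simp add: mult.assoc)
  moreover have "- (e - a \<bullet> v) * h = - (e * h) + h * (a \<bullet> v)" by (simp add: algebra_simps)
  moreover have "0 < e * h" using \<open>0 < e\<close> h(1) by simp
  ultimately show False by linarith
qed

text \<open>The limit \<open>y\<close> of the dual curves takes values in the compact set \<open>grad \<phi> ` K\<close>, on which the
  inverse of the gradient is uniformly continuous. Applying that inverse turns uniform convergence
  of the dual curves into uniform convergence of the iterates.\<close>
lemma limit_trajectory:
  assumes \<kappa>: "strict_mono \<kappa>" and lim: "(\<lambda>j. x (\<kappa> j)) \<longlonglongrightarrow> u"
  obtains r z where "strict_mono (r :: nat \<Rightarrow> nat)" "trajectory \<phi> H z" "z 0 = u"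
    "continuous_on {0..} z"
    "\<And>T. uniform_limit {0..T} (\<lambda>j s. x (current (\<kappa> (r j)) s)) z sequentially"
proof -
  obtain D where D: "\<And>i. norm (d i) \<le> D" using bounded_d unfolding bounded_iff by blast
  have "0 \<le> D" using D[of 0] norm_ge_zero order_trans by blast
  define K where "K = closure (range x)"
  have xK: "x i \<in> K" for i unfolding K_def by (rule closure_subset[THEN subsetD]) simp
  have "compact K" using bounded_x by (simp add: K_def compact_closure)
  have cont_K: "continuous_on K (grad \<phi>)" using cont_grad by (rule continuous_on_subset) simp
  have comp: "compact (grad \<phi> ` K)" using cont_K \<open>compact K\<close> by (rule compact_continuous_image)
  define g where "g = inv (grad \<phi>)"
  have g: "g (grad \<phi> w) = w" for w using inj_grad by (simp add: g_def)
  have g_cont: "continuous_on (grad \<phi> ` K) g"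
    by (rule continuous_on_inv[OF cont_K \<open>compact K\<close>]) (simp add: g)
  obtain R where R: "\<And>w. w \<in> grad \<phi> ` K \<Longrightarrow> norm w \<le> R"
    using compact_imp_bounded[OF comp] unfolding bounded_iff by blast
  obtain r y where r: "strict_mono (r :: nat \<Rightarrow> nat)" and y: "D-lipschitz_on {0..} y"
    and y_lim: "\<And>T. uniform_limit {0..T} (\<lambda>j s. grad \<phi> (x (current (\<kappa> (r j)) s))) y sequentially"
  proof (rule asymptotically_lipschitz_subsequence[of "\<lambda>j s. grad \<phi> (x (current (\<kappa> j) s))" R D])
    show "norm (grad \<phi> (x (current (\<kappa> j) t))) \<le> R" for j t by (intro R imageI xK)
    show "\<forall>\<^sub>F j in sequentially. \<forall>s\<in>{0..T}. \<forall>t\<in>{0..T}.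
        norm (grad \<phi> (x (current (\<kappa> j) s)) - grad \<phi> (x (current (\<kappa> j) t))) \<le> D * \<bar>s - t\<bar> + e"
      if "0 < e" for T e
      using eventually_subseq[OF \<kappa> asymptotically_lipschitz[OF D that, where T = T]] by simp
  qed (use \<open>0 \<le> D\<close> in auto)
  have y_K: "y t \<in> grad \<phi> ` K" if "0 \<le> t" for t
  proof (rule Lim_in_closed_set[OF compact_imp_closed[OF comp] _ sequentially_bot])
    show "(\<lambda>j. grad \<phi> (x (current (\<kappa> (r j)) t))) \<longlonglongrightarrow> y t"
      using tendsto_uniform_limitI[OF y_lim[of t], of t] that by simp
  qed (simp add: xK)
  define z where "z = (\<lambda>t. g (y t))"
  have grad_z: "grad \<phi> (z t) = y t" if "0 \<le> t" for t
    using y_K[OF that] by (auto simp: z_def g)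
  have z_lim: "uniform_limit {0..T} (\<lambda>j s. x (current (\<kappa> (r j)) s)) z sequentially" for T
  proof -
    have "uniform_limit {0..T} (\<lambda>j s. g (grad \<phi> (x (current (\<kappa> (r j)) s)))) (\<lambda>s. g (y s)) sequentially"
      by (rule uniform_limit_compose_uniformly_continuous_on[OF y_lim
            compact_uniformly_continuous[OF g_cont comp] _ compact_imp_closed[OF comp]])
        (simp add: xK)
    then show ?thesis by (simp add: g z_def)
  qed
  have z_cont: "continuous_on {0..} z"
    unfolding z_def using lipschitz_on_continuous_on[OF y] g_cont y_K
    by (intro continuous_on_compose2[OF g_cont]) auto
  have \<mu>: "filterlim (\<lambda>j. \<kappa> (r j)) at_top sequentially"
    using filterlim_subseq[OF strict_mono_o[OF \<kappa> r]] by (simp add: o_def)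
  have "z 0 = u"
  proof (rule LIMSEQ_unique)
    show "(\<lambda>j. x (\<kappa> (r j))) \<longlonglongrightarrow> z 0"
      using tendsto_uniform_limitI[OF z_lim[of 0], of 0] by (simp add: current_0)
    show "(\<lambda>j. x (\<kappa> (r j))) \<longlonglongrightarrow> u"
      using LIMSEQ_subseq_LIMSEQ[OF lim r] by (simp add: o_def)
  qed
  have "trajectory \<phi> H z"
    unfolding trajectory_def
  proof (intro conjI allI impI)
    fix T :: real
    have "D-lipschitz_on {0..T} (\<lambda>t. grad \<phi> (z t))"
      by (rule lipschitz_on_transform[OF lipschitz_on_subset[OF y]]) (auto simp: grad_z)
    then show "abs_cont_on {0..T} (\<lambda>t. grad \<phi> (z t))" by (rule lipschitz_imp_abs_cont_on)
  next
    \<comment> \<open>Only times \<open>t \<ge> 0\<close> matter; the curve is frozen at negative times.\<close>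
    have "D-lipschitz_on UNIV (\<lambda>t. y (max 0 t))"
    proof (rule lipschitz_onI[OF _ \<open>0 \<le> D\<close>])
      fix s t :: real
      have "dist (y (max 0 s)) (y (max 0 t)) \<le> D * dist (max 0 s) (max 0 t)"
        by (rule lipschitz_onD[OF y]) auto
      also have "\<dots> \<le> D * dist s t"
        using \<open>0 \<le> D\<close> by (intro mult_left_mono) (auto simp: dist_real_def)
      finally show "dist (y (max 0 s)) (y (max 0 t)) \<le> D * dist s t" .
    qed
    then have "AE t in lebesgue. (\<lambda>t. y (max 0 t)) differentiable (at t)"
      by (rule lipschitz_AE_differentiable)
    then show "AE t in lebesgue. 0 \<le> t \<longrightarrow> (\<exists>v. ((\<lambda>s. grad \<phi> (z s)) has_vector_derivative v)
        (at t within {0..}) \<and> v \<in> uminus ` H (z t))"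
    proof eventually_elim
      case (elim t)
      show ?case
      proof
        assume "0 \<le> t"
        obtain v where "((\<lambda>t. y (max 0 t)) has_vector_derivative v) (at t)"
          using elim by (auto simp: vector_derivative_works)
        then have "((\<lambda>t. y (max 0 t)) has_vector_derivative v) (at t within {0..})"
          by (rule has_vector_derivative_at_within)
        then have v: "((\<lambda>s. grad \<phi> (z s)) has_vector_derivative v) (at t within {0..})"
          by (rule has_vector_derivative_transform[rotated 2]) (use \<open>0 \<le> t\<close> in \<open>auto simp: grad_z\<close>)
        have "- v \<in> H (z t)"
          by (rule limit_velocity_in_H[OF \<mu> \<open>0 \<le> t\<close> _ z_lim[of "t + 1"] z_cont v]) simp
        then have "v \<in> uminus ` H (z t)" by (metis image_eqI minus_minus)
        with v show "\<exists>v. ((\<lambda>s. grad \<phi> (z s)) has_vector_derivative v)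
          (at t within {0..}) \<and> v \<in> uminus ` H (z t)" by blast
      qed
    qed
  qed
  then show thesis using that r \<open>z 0 = u\<close> z_cont z_lim by blast
qed
end

section \<open>Convergence of the values and stability of the cluster points\<close>

text \<open>A divergent bounded sequence has two cluster values, and the open interval between them
  contains a level outside \<open>C\<close>.\<close>
lemma divergent_upcrossings:
  fixes u :: "nat \<Rightarrow> real"
  assumes bounded: "bounded (range u)" and "\<not> convergent u" and "interior C = {}"
  obtains a b where "a < b" "a \<notin> C"
    "\<And>N. \<exists>i\<ge>N. \<exists>e>i. u i \<le> a \<and> (\<forall>k. i < k \<and> k \<le> e \<longrightarrow> a < u k) \<and> b < u e"
proof -
  obtain l1 r1 where r1: "strict_mono (r1 :: nat \<Rightarrow> nat)" "(u \<circ> r1) \<longlonglongrightarrow> l1"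
    using bounded_imp_convergent_subsequence[OF bounded] by blast
  have "\<not> u \<longlonglongrightarrow> l1" using \<open>\<not> convergent u\<close> by (auto simp: convergent_def)
  then obtain \<epsilon> where \<epsilon>: "0 < \<epsilon>" "\<And>N. \<exists>k\<ge>N. \<epsilon> \<le> dist (u k) l1"
    unfolding lim_sequentially by (meson not_less)
  then have "infinite {k. \<epsilon> \<le> dist (u k) l1}"
    unfolding infinite_nat_iff_unbounded_le by simp
  then obtain s where s: "strict_mono (s :: nat \<Rightarrow> nat)" "\<And>n. \<epsilon> \<le> dist (u (s n)) l1"
    using infinite_enumerate[of "{k. \<epsilon> \<le> dist (u k) l1}"] by auto
  have "bounded (range (u \<circ> s))" by (rule bounded_subset[OF bounded]) auto
  then obtain l2 r where r: "strict_mono (r :: nat \<Rightarrow> nat)" "((u \<circ> s) \<circ> r) \<longlonglongrightarrow> l2"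
    using bounded_imp_convergent_subsequence by blast
  define r2 where "r2 = s \<circ> r"
  have r2: "strict_mono r2" "(u \<circ> r2) \<longlonglongrightarrow> l2"
    using s(1) r by (auto simp: r2_def strict_mono_o comp_assoc)
  have "\<epsilon> \<le> dist l2 l1"
    by (rule tendsto_lowerbound[OF tendsto_dist[OF r2(2) tendsto_const]])
      (use s(2) in \<open>auto simp: r2_def\<close>)
  then have "l1 \<noteq> l2" using \<epsilon>(1) by auto
  then obtain lo hi \<alpha> \<beta> where lohi: "lo < hi" and
      \<alpha>: "strict_mono (\<alpha> :: nat \<Rightarrow> nat)" "(u \<circ> \<alpha>) \<longlonglongrightarrow> lo" and
      \<beta>: "strict_mono (\<beta> :: nat \<Rightarrow> nat)" "(u \<circ> \<beta>) \<longlonglongrightarrow> hi"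
    using r1 r2 by (metis linorder_less_linear)
  have "\<not> {lo<..<hi} \<subseteq> C"
    using interior_maximal[of "{lo<..<hi}" C] \<open>interior C = {}\<close> lohi by auto
  then obtain a where "a \<in> {lo<..<hi}" "a \<notin> C" by blast
  then have a: "lo < a" "a < hi" "a \<notin> C" by auto
  then obtain b where b: "a < b" "b < hi" using dense by blast
  have low: "\<exists>k\<ge>N. u k < a" for N
  proof -
    have "\<forall>\<^sub>F j in sequentially. N \<le> j \<and> (u \<circ> \<alpha>) j < a"
      using order_tendstoD(2)[OF \<alpha>(2) a(1)] eventually_ge_at_top[of N] by (rule eventually_conj[rotated])
    then obtain j where "N \<le> j" "(u \<circ> \<alpha>) j < a"
      unfolding eventually_sequentially by blast
    then show ?thesis using seq_suble[OF \<alpha>(1), of j] by (intro exI[of _ "\<alpha> j"]) simp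
  qed
  have high: "\<exists>k\<ge>N. b < u k" for N
  proof -
    have "\<forall>\<^sub>F j in sequentially. N \<le> j \<and> b < (u \<circ> \<beta>) j"
      using order_tendstoD(1)[OF \<beta>(2) b(2)] eventually_ge_at_top[of N] by (rule eventually_conj[rotated])
    then obtain j where "N \<le> j" "b < (u \<circ> \<beta>) j"
      unfolding eventually_sequentially by blast
    then show ?thesis using seq_suble[OF \<beta>(1), of j] by (intro exI[of _ "\<beta> j"]) simp
  qed
  have "\<exists>i\<ge>N. \<exists>e>i. u i \<le> a \<and> (\<forall>k. i < k \<and> k \<le> e \<longrightarrow> a < u k) \<and> b < u e" for N
  proof -
    obtain k1 where k1: "N \<le> k1" "u k1 < a" using low by blast
    obtain e where e: "k1 \<le> e" "b < u e" using high by blast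
    \<comment> \<open>\<open>Max A\<close> is the last visit to the sublevel set before the excursion.\<close>
    define A where "A = {k. k1 \<le> k \<and> k \<le> e \<and> u k \<le> a}"
    have fin: "finite A" by (rule finite_subset[of _ "{..e}"]) (auto simp: A_def)
    have "k1 \<in> A" using k1 e by (simp add: A_def)
    then have i: "Max A \<in> A" using fin by (intro Max_in) auto
    then have i': "N \<le> Max A" "Max A \<le> e" "u (Max A) \<le> a" using k1 by (auto simp: A_def)
    then have "Max A \<noteq> e" using e(2) b(1) by auto
    then have "Max A < e" using i'(2) by simp
    moreover have "a < u k" if "Max A < k" "k \<le> e" for k
    proof (rule ccontr)
      assume "\<not> a < u k"
      then have "k \<in> A" using that i by (simp add: A_def)
      then have "k \<le> Max A" using fin by (rule Max_ge[rotated])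
      then show False using that(1) by simp
    qed
    ultimately show ?thesis using i' e(2) by (intro exI[of _ "Max A"]) auto
  qed
  with b(1) a(3) show thesis by (rule that)
qed

locale lyapunov_scheme = averaged_inclusion_scheme \<phi> H \<eta> x d \<xi>
  for \<phi> :: "'a::euclidean_space \<Rightarrow> real" and H \<eta> x d \<xi> +
  fixes \<Psi> :: "'a \<Rightarrow> real"
  assumes Psi_cont: "continuous_on UNIV \<Psi>"
    and descent: "\<And>z. trajectory \<phi> H z \<Longrightarrow> z 0 \<notin> stable_set H \<Longrightarrow>
      \<exists>T>0. \<Psi> (z T) < (SUP t\<in>{0..T}. \<Psi> (z t)) \<and> (SUP t\<in>{0..T}. \<Psi> (z t)) \<le> \<Psi> (z 0)"
begin

lemma limit_trajectory_values:
  assumes "strict_mono \<kappa>" "(\<lambda>j. x (\<kappa> j)) \<longlonglongrightarrow> u"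
  obtains \<mu> z where "strict_mono (\<mu> :: nat \<Rightarrow> nat)" "range \<mu> \<subseteq> range \<kappa>"
    "trajectory \<phi> H z" "z 0 = u" "continuous_on {0..} (\<lambda>t. \<Psi> (z t))"
    "\<And>T. uniform_limit {0..T} (\<lambda>j t. \<Psi> (x (current (\<mu> j) t))) (\<lambda>t. \<Psi> (z t)) sequentially"
proof -
  obtain r z where r: "strict_mono (r :: nat \<Rightarrow> nat)" and z: "trajectory \<phi> H z" "z 0 = u"
      "continuous_on {0..} z"
    and lim: "\<And>T. uniform_limit {0..T} (\<lambda>j s. x (current (\<kappa> (r j)) s)) z sequentially"
    using limit_trajectory[OF assms] by blast
  define K where "K = closure (range x)"
  have "compact K" using bounded_x by (simp add: K_def compact_closure)
  have xK: "x i \<in> K" for i unfolding K_def by (rule closure_subset[THEN subsetD]) simp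
  have Psi_K: "uniformly_continuous_on K \<Psi>"
    using continuous_on_subset[OF Psi_cont subset_UNIV] \<open>compact K\<close>
    by (rule compact_uniformly_continuous)
  show thesis
  proof
    show "strict_mono (\<kappa> \<circ> r)" using assms(1) r by (rule strict_mono_o)
    show "range (\<kappa> \<circ> r) \<subseteq> range \<kappa>" by auto
    show "uniform_limit {0..T} (\<lambda>j t. \<Psi> (x (current ((\<kappa> \<circ> r) j) t))) (\<lambda>t. \<Psi> (z t)) sequentially"
      for T
      unfolding o_def
      by (rule uniform_limit_compose_uniformly_continuous_on[OF lim Psi_K])
        (simp_all add: xK K_def[symmetric] compact_imp_closed[OF \<open>compact K\<close>])
    show "continuous_on {0..} (\<lambda>t. \<Psi> (z t))"
      by (rule continuous_on_compose2[OF Psi_cont z(3)]) simp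
  qed (use z in auto)
qed

text \<open>Along a limit trajectory through \<open>u\<close> the function \<open>\<Psi>\<close> is constantly the limit of
  \<open>\<Psi> (x k)\<close>, which rules out a strict decrease.\<close>
lemma limit_point_stable:
  assumes conv: "convergent (\<lambda>k. \<Psi> (x k))" and \<kappa>: "strict_mono \<kappa>" "(\<lambda>j. x (\<kappa> j)) \<longlonglongrightarrow> u"
  shows "u \<in> stable_set H"
proof (rule ccontr)
  assume u: "u \<notin> stable_set H"
  obtain L where L: "(\<lambda>k. \<Psi> (x k)) \<longlonglongrightarrow> L" using conv unfolding convergent_def by blast
  obtain \<mu> z where \<mu>: "strict_mono (\<mu> :: nat \<Rightarrow> nat)" and z: "trajectory \<phi> H z" "z 0 = u"
    and lim: "\<And>T. uniform_limit {0..T} (\<lambda>j t. \<Psi> (x (current (\<mu> j) t))) (\<lambda>t. \<Psi> (z t)) sequentially"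
    using limit_trajectory_values[OF \<kappa>] by blast
  have const: "\<Psi> (z t) = L" if "0 \<le> t" for t
  proof (rule LIMSEQ_unique)
    show "(\<lambda>j. \<Psi> (x (current (\<mu> j) t))) \<longlonglongrightarrow> \<Psi> (z t)"
      using tendsto_uniform_limitI[OF lim[of t], of t] that by simp
    have "filterlim (\<lambda>j. current (\<mu> j) t) at_top sequentially"
      using filterlim_subseq[OF \<mu>] by (rule filterlim_at_top_mono) (simp add: le_current that)
    then show "(\<lambda>j. \<Psi> (x (current (\<mu> j) t))) \<longlonglongrightarrow> L" by (rule filterlim_compose[OF L])
  qed
  obtain T where T: "0 < T" "\<Psi> (z T) < (SUP t\<in>{0..T}. \<Psi> (z t))"
    using descent[OF z(1)] u z(2) by auto
  have "(\<lambda>t. \<Psi> (z t)) ` {0..T} = {L}" using const T(1) by force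
  then show False using T const[of T] by simp
qed

text \<open>Each upcrossing starts with the step that leaves \<open>{\<Psi> \<le> a}\<close>, so limit points of the starting
  iterates lie on the level \<open>a\<close> and are unstable. From there the trajectory descends: it
  stays in \<open>{\<Psi> \<le> a}\<close> on \<open>[0, T]\<close> and ends strictly below \<open>a\<close>. An iterate following it
  within \<open>\<epsilon>\<close> neither exceeds \<open>b\<close> before time \<open>T\<close> nor remains above \<open>a\<close> until then.\<close>
lemma no_upcrossings_of_noncritical_value:
  assumes "a < b" and a: "a \<notin> {\<Psi> u | u. 0 \<in> H u}"
    and up: "\<And>N. \<exists>i\<ge>N. \<exists>e>i. \<Psi> (x i) \<le> a \<and> (\<forall>k. i < k \<and> k \<le> e \<longrightarrow> a < \<Psi> (x k)) \<and> b < \<Psi> (x e)"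
  shows False
proof -
  define upcrossing where "upcrossing = (\<lambda>i e. i < e \<and> \<Psi> (x i) \<le> a \<and>
    (\<forall>k. i < k \<and> k \<le> e \<longrightarrow> a < \<Psi> (x k)) \<and> b < \<Psi> (x e))"
  have upD: "i < e" "\<Psi> (x i) \<le> a" "\<And>k. i < k \<Longrightarrow> k \<le> e \<Longrightarrow> a < \<Psi> (x k)" "b < \<Psi> (x e)"
    if "upcrossing i e" for i e
    using that by (auto simp: upcrossing_def)
  have "\<exists>i\<ge>N. \<exists>e. upcrossing i e" for N
    using up[of N] unfolding upcrossing_def by blast
  then have "infinite {i. \<exists>e. upcrossing i e}"
    unfolding infinite_nat_iff_unbounded_le by simp
  then obtain \<iota> where \<iota>: "strict_mono (\<iota> :: nat \<Rightarrow> nat)" "\<And>n. \<exists>e. upcrossing (\<iota> n) e"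
    using infinite_enumerate[of "{i. \<exists>e. upcrossing i e}"] by auto
  have "bounded (range (x \<circ> \<iota>))" by (rule bounded_subset[OF bounded_x]) auto
  then obtain u r where r: "strict_mono (r :: nat \<Rightarrow> nat)" "((x \<circ> \<iota>) \<circ> r) \<longlonglongrightarrow> u"
    using bounded_imp_convergent_subsequence by blast
  have "strict_mono (\<iota> \<circ> r)" using \<iota>(1) r(1) by (rule strict_mono_o)
  moreover have "(\<lambda>j. x ((\<iota> \<circ> r) j)) \<longlonglongrightarrow> u" using r(2) by (simp add: o_def)
  ultimately obtain \<mu> z where \<mu>: "strict_mono (\<mu> :: nat \<Rightarrow> nat)" "range \<mu> \<subseteq> range (\<iota> \<circ> r)"
    and z: "trajectory \<phi> H z" "z 0 = u" "continuous_on {0..} (\<lambda>t. \<Psi> (z t))"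
    and lim: "\<And>T. uniform_limit {0..T} (\<lambda>j t. \<Psi> (x (current (\<mu> j) t))) (\<lambda>t. \<Psi> (z t)) sequentially"
    using limit_trajectory_values[of "\<iota> \<circ> r" u] by blast
  have near: "\<forall>\<^sub>F j in sequentially. \<forall>t\<in>{0..T}. \<bar>\<Psi> (x (current (\<mu> j) t)) - \<Psi> (z t)\<bar> < \<epsilon>"
    if "0 < \<epsilon>" for T \<epsilon>
    using lim[of T] that unfolding uniform_limit_iff dist_real_def by blast
  have up_\<mu>: "\<exists>e. upcrossing (\<mu> j) e" for j
  proof -
    have "\<mu> j \<in> range (\<iota> \<circ> r)" using \<mu>(2) by (rule subsetD) simp
    then obtain n where "\<mu> j = \<iota> (r n)" by auto
    then show ?thesis using \<iota>(2)[of "r n"] by simp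
  qed
  have at_top: "filterlim \<mu> at_top sequentially" using \<mu>(1) by (rule filterlim_subseq)
  have eta_\<mu>: "(\<lambda>j. \<eta> (\<mu> j)) \<longlonglongrightarrow> 0" by (rule filterlim_compose[OF eta_lim at_top])
  have z0: "(\<lambda>j. \<Psi> (x (\<mu> j))) \<longlonglongrightarrow> \<Psi> u"
    using tendsto_uniform_limitI[OF lim[of 0], of 0] z(2) by (simp add: current_0)
  have "\<Psi> u = a"
  proof (rule antisym)
    show "\<Psi> u \<le> a" by (rule LIMSEQ_le_const2[OF z0]) (use up_\<mu> upD(2) in blast)
    show "a \<le> \<Psi> u"
    proof (rule ccontr)
      assume "\<not> a \<le> \<Psi> u"
      define \<epsilon> where "\<epsilon> = (a - \<Psi> u) / 2"
      have "0 < \<epsilon>" using \<open>\<not> a \<le> \<Psi> u\<close> by (simp add: \<epsilon>_def)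
      have "(\<lambda>j. \<Psi> (z (\<eta> (\<mu> j)))) \<longlonglongrightarrow> \<Psi> (z 0)"
        by (rule continuous_on_tendsto_compose[OF z(3) eta_\<mu>])
          (auto intro!: always_eventually less_imp_le eta_pos)
      then have "\<forall>\<^sub>F j in sequentially. \<Psi> (z (\<eta> (\<mu> j))) < \<Psi> u + \<epsilon>"
        by (rule order_tendstoD(2)) (use z(2) \<open>0 < \<epsilon>\<close> in simp)
      moreover have "\<forall>\<^sub>F j in sequentially. \<eta> (\<mu> j) < 1"
        using eta_\<mu> by (rule order_tendstoD(2)) simp
      ultimately have "\<forall>\<^sub>F j in sequentially. False"
        using near[OF \<open>0 < \<epsilon>\<close>, of 1]
      proof eventually_elim
        case (elim j)
        have "current (\<mu> j) (\<eta> (\<mu> j)) = Suc (\<mu> j)"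
          using current_step_time[of "\<mu> j" "Suc (\<mu> j)"] by (simp add: step_time_Suc)
        moreover have "\<eta> (\<mu> j) \<in> {0..1}" using elim(2) eta_pos[of "\<mu> j"] by simp
        ultimately have "\<bar>\<Psi> (x (Suc (\<mu> j))) - \<Psi> (z (\<eta> (\<mu> j)))\<bar> < \<epsilon>" using elim(3) by metis
        then have "\<Psi> (x (Suc (\<mu> j))) < \<Psi> u + \<epsilon> + \<epsilon>" using elim(1) by linarith
        then have "\<Psi> (x (Suc (\<mu> j))) < a" by (simp add: \<epsilon>_def)
        moreover obtain e where e: "upcrossing (\<mu> j) e" using up_\<mu> by blast
        have "a < \<Psi> (x (Suc (\<mu> j)))" by (rule upD(3)[OF e]) (use upD(1)[OF e] in simp_all)
        ultimately show False by simp
      qed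
      then show False by simp
    qed
  qed
  then have "u \<notin> stable_set H" using a unfolding stable_set_def by blast
  then obtain T where T: "0 < T" "\<Psi> (z T) < (SUP t\<in>{0..T}. \<Psi> (z t))"
      "(SUP t\<in>{0..T}. \<Psi> (z t)) \<le> a"
    using descent[OF z(1)] z(2) \<open>\<Psi> u = a\<close> by auto
  have "compact ((\<lambda>t. \<Psi> (z t)) ` {0..T})"
    by (rule compact_continuous_image[OF continuous_on_subset[OF z(3)]]) auto
  then have bdd: "bdd_above ((\<lambda>t. \<Psi> (z t)) ` {0..T})"
    by (intro bounded_imp_bdd_above compact_imp_bounded)
  have below: "\<Psi> (z t) \<le> a" if "t \<in> {0..T}" for t
    using cSUP_upper[OF that bdd] T(3) by linarith
  define \<epsilon> where "\<epsilon> = min (b - a) (a - \<Psi> (z T))"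
  have \<epsilon>: "0 < \<epsilon>" "\<epsilon> \<le> b - a" "\<epsilon> \<le> a - \<Psi> (z T)"
    using T \<open>a < b\<close> by (auto simp: \<epsilon>_def)
  have "\<forall>\<^sub>F j in sequentially. \<eta> (\<mu> j) < T"
    using eta_\<mu> T(1) by (rule order_tendstoD(2))
  then have "\<forall>\<^sub>F j in sequentially. False"
    using near[OF \<epsilon>(1), of T]
  proof eventually_elim
    case (elim j)
    let ?i = "\<mu> j"
    obtain e where e: "upcrossing ?i e" using up_\<mu> by blast
    show False
    proof (cases "e \<le> current ?i T")
      case True
      then obtain t where t: "0 \<le> t" "t \<le> T" "current ?i t = e"
        using current_intermediate[of 0 T ?i e] upD(1)[OF e] T(1)
        by (metis current_0 less_imp_le order_refl)
      then have "\<bar>\<Psi> (x e) - \<Psi> (z t)\<bar> < \<epsilon>" "\<Psi> (z t) \<le> a" using elim(2) below by auto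
      then show False using upD(4)[OF e] \<epsilon>(2) by linarith
    next
      case False
      have "Suc ?i \<le> current ?i T"
        using elim(1) T(1) by (simp add: le_current_iff step_time_Suc)
      then have "a < \<Psi> (x (current ?i T))" using upD(3)[OF e] False by simp
      moreover have "\<bar>\<Psi> (x (current ?i T)) - \<Psi> (z T)\<bar> < \<epsilon>" using elim(2) T(1) by simp
      ultimately show False using \<epsilon>(3) by linarith
    qed
  qed
  then show False by simp
qed

lemma convergent_values:
  assumes sard: "interior {\<Psi> u | u. 0 \<in> H u} = {}"
  shows "convergent (\<lambda>k. \<Psi> (x k))"
proof (rule ccontr)
  assume div: "\<not> convergent (\<lambda>k. \<Psi> (x k))"
  have "compact (\<Psi> ` closure (range x))"
    using continuous_on_subset[OF Psi_cont subset_UNIV] bounded_x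
    by (intro compact_continuous_image) (simp_all add: compact_closure)
  then have "bounded (\<Psi> ` closure (range x))" by (rule compact_imp_bounded)
  then have "bounded (range (\<lambda>k. \<Psi> (x k)))"
    by (rule bounded_subset) (use closure_subset[of "range x"] in blast)
  then obtain a b where "a < b" "a \<notin> {\<Psi> u | u. 0 \<in> H u}"
      "\<And>N. \<exists>i\<ge>N. \<exists>e>i. \<Psi> (x i) \<le> a \<and> (\<forall>k. i < k \<and> k \<le> e \<longrightarrow> a < \<Psi> (x k)) \<and> b < \<Psi> (x e)"
    using divergent_upcrossings[OF _ div sard] by blast
  then show False by (rule no_upcrossings_of_noncritical_value)
qed

end

theorem theorem3p2:
  fixes \<phi> \<Psi> :: "real ^ 'n \<Rightarrow> real"
    and H :: "real ^ 'n \<Rightarrow> (real ^ 'n) set"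
    and \<eta> :: "nat \<Rightarrow> real"
    and x d \<xi> :: "nat \<Rightarrow> real ^ 'n"
  assumes eta_pos: "\<And>k. \<eta> k > 0"
    and update: "\<And>k. grad \<phi> (x (Suc k)) = grad \<phi> (x k) - \<eta> k *\<^sub>R (d k + \<xi> k)"
    and kernel: "legendre_kernel \<phi>" "supercoercive \<phi>"
    and grad_diff: "AE u in lebesgue. grad \<phi> differentiable (at u)"
    and bounded: "bounded (range x)" "bounded (range (\<lambda>k. grad \<phi> (x k)))" "bounded (range d)"
    and eta_sum: "filterlim (\<lambda>n. \<Sum>k<n. \<eta> k) at_top sequentially"
    and eta_lim: "\<eta> \<longlonglongrightarrow> 0"
    and noise: "\<And>T. T > 0 \<Longrightarrow>
      (\<lambda>s. SUP i\<in>{s..step_index \<eta> (step_time \<eta> s + T)}. norm (\<Sum>k=s..i. \<eta> k *\<^sub>R \<xi> k))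
        \<longlonglongrightarrow> 0"
    and graph: "closed_graph H"
    and averages: "\<And>(\<kappa>::nat \<Rightarrow> nat) xbar. strict_mono \<kappa> \<Longrightarrow> (\<lambda>j. x (\<kappa> j)) \<longlonglongrightarrow> xbar \<Longrightarrow>
      (\<lambda>N. edist_set ((1 / real N) *\<^sub>R (\<Sum>j<N. d (\<kappa> j))) (H xbar)) \<longlonglongrightarrow> 0"
    and Psi_cont: "continuous_on UNIV \<Psi>"
    and sard: "interior {\<Psi> u | u. 0 \<in> H u} = {}"
    and Psi_bdd: "bdd_below (range \<Psi>)"
    and descent: "\<And>z. trajectory \<phi> H z \<Longrightarrow> z 0 \<notin> stable_set H \<Longrightarrow>
      \<exists>T>0. \<Psi> (z T) < (SUP t\<in>{0..T}. \<Psi> (z t)) \<and> (SUP t\<in>{0..T}. \<Psi> (z t)) \<le> \<Psi> (z 0)"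
  shows "(\<forall>xbar. cluster_point x xbar \<longrightarrow> xbar \<in> stable_set H) \<and>
         convergent (\<lambda>k. \<Psi> (x k))"
proof -
  have "GDERIV \<phi> u :> grad \<phi> u" for u
    using kernel(1) gderiv_grad unfolding legendre_kernel_def C1_function_def by blast
  then have inj: "inj (grad \<phi>)"
    using kernel(1) unfolding legendre_kernel_def by (intro strictly_convex_inj_grad) auto
  have cont: "continuous_on UNIV (grad \<phi>)"
    using kernel(1) unfolding legendre_kernel_def C1_function_def by blast
  have closed: "closed (H u)" for u
  proof -
    have "H u = (\<lambda>v. (u, v)) -` {(x, y). y \<in> H x}" by auto
    moreover have "closed \<dots>"
      using graph unfolding closed_graph_def
      by (intro continuous_closed_vimage continuous_intros) auto
    ultimately show ?thesis by simp
  qed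
  interpret lyapunov_scheme \<phi> H \<eta> x d \<xi> \<Psi>
    by unfold_locales (fact eta_pos update inj cont bounded eta_sum eta_lim noise closed averages
        Psi_cont descent)+
  have conv: "convergent (\<lambda>k. \<Psi> (x k))" using sard by (rule convergent_values)
  then show ?thesis using limit_point_stable unfolding cluster_point_def by blast
qed

end
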